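(* Let $h(n)$ denote the maximum number of triangles all of whose angles are between $59^\circ$ and $61^\circ$ in any $n$-element planar set. Then $$h(n)=\frac{n^3}{24}+O(n\log n)\qquad\text{as } n\to\infty.$$
   Context: Triangles of a planar point set are the triangles whose three vertices belong to the set. "Between" is understood strictly, i.e. each angle $\theta$ satisfies $|\theta-60^\circ|<1^\circ$. *)

theory Defs
  imports "HOL-Analysis.Analysis" "HOL-Library.Landau_Symbols"
begin

text \<open>The angle at the vertex \<open>b\<close> of the triangle \<open>a b c\<close>, in degrees.\<close>

definition angle_deg :: "real^2 \<Rightarrow> real^2 \<Rightarrow> real^2 \<Rightarrow> real" where
  "angle_deg a b c =
     arccos (inner (a - b) (c - b) / (norm (a - b) * norm (c - b))) * (180 / pi)"

text \<open>A triangle is identified with its set of three vertices, so each triangle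
  is counted once.\<close>

definition triangles :: "(real^2) set \<Rightarrow> (real^2) set set" where
  "triangles P = {T. T \<subseteq> P \<and> card T = 3 \<and> \<not> collinear T}"

definition almost_regular :: "(real^2) set \<Rightarrow> bool" where
  "almost_regular T \<longleftrightarrow>
     (\<forall>a\<in>T. \<forall>b\<in>T. \<forall>c\<in>T. a \<noteq> b \<and> b \<noteq> c \<and> a \<noteq> c \<longrightarrow>
        59 < angle_deg a b c \<and> angle_deg a b c < 61)"

definition h :: "nat \<Rightarrow> nat" where
  "h n = Max {card {T \<in> triangles P. almost_regular T} | P. finite P \<and> card P = n}"

text \<open>The set in the definition of \<open>h\<close> is finite and nonempty, so that \<open>Max\<close> is the
  genuine maximum.\<close>

lemma h_set_finite:
  "finite {card {T \<in> triangles P. almost_regular T} | P. finite P \<and> card P = n}"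
proof (rule finite_subset)
  show "{card {T \<in> triangles P. almost_regular T} | P. finite P \<and> card P = n} \<subseteq> {..2 ^ n}"
  proof clarsimp
    fix P :: "(real^2) set"
    assume P: "finite P"
    have "card {T \<in> triangles P. almost_regular T} \<le> card (Pow P)"
      using P by (intro card_mono) (auto simp: triangles_def)
    then show "card {T \<in> triangles P. almost_regular T} \<le> 2 ^ card P"
      by (simp add: card_Pow P)
  qed
qed simp

lemma h_set_nonempty:
  "{card {T \<in> triangles P. almost_regular T} | P. finite P \<and> card P = n} \<noteq> {}"
proof -
  have "infinite (UNIV :: (real^2) set)"
    by (rule infinite_UNIV_char_0)
  then obtain P :: "(real^2) set" where "finite P" "card P = n"
    using infinite_arbitrarily_large by blast
  then show ?thesis by blast
qed

end

theory Submission
  imports Defs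
begin

text \<open>Lower bound. Three tiny copies of optimal sets with \<open>a\<close>, \<open>b\<close>, \<open>c\<close> points, placed at the vertices
  of a regular triangle, show \<open>h (a + b + c) \<ge> a * b * c + h a + h b + h c\<close> (\<open>h_superadditive\<close>). With
  parts as equal as possible, the main terms add up to \<open>n ^ 3 / 24\<close> because
  \<open>1/27 * (1 + 1/9 + 1/81 + \<dots>) = 1/24\<close>. Unequal parts lose \<open>O(k)\<close> in a cluster of size \<open>k\<close>,
  hence \<open>O(n)\<close> on each of the \<open>O(log n)\<close> levels of the recursion (\<open>h_ge\<close>).

  Upper bound. In fact every set has at most \<open>n ^ 3 / 24\<close> nearly regular triangles. Give the
  points \<open>p\<close> nonnegative weights \<open>x p\<close>, let each triangle count as the product of the weights of its
  vertices, and show by induction on the number of points that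
  \<open>weight x S + (\<Sum>p\<in>S. x p ^ 3) / 24 \<le> (\<Sum>p\<in>S. x p) ^ 3 / 24\<close> (\<open>weight_bound\<close>). If some two points
  lie in no common triangle, the left side does not decrease when the whole weight of a suitable one of
  them is moved to the other, and there is one point less. Otherwise every pair of points lies in a
  triangle, and the set is very rigid: it splits into three nonempty parts such that each
  triangle is inside one part or has a vertex in each (\<open>splits_if_covered\<close>). The induction
  hypothesis for the three parts, with total weights \<open>a\<close>, \<open>b\<close>, \<open>c\<close>, and the inequality
  \<open>a * b * c + (a ^ 3 + b ^ 3 + c ^ 3) / 24 \<le> (a + b + c) ^ 3 / 24\<close> finish the proof.

  The rigidity comes from a diameter \<open>u v\<close> of the set, of length 1, say. It belongs to a triangle
  \<open>u v w\<close>. For a further point \<open>x\<close>, the pair \<open>u\<close>, \<open>x\<close> belongs to a triangle whose third vertex is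
  nearly \<open>x\<close> rotated by 60 degrees about \<open>u\<close>, and this vertex is within distance 1 of \<open>v\<close> and \<open>w\<close>. Hence
  \<open>x\<close> is nearly within distance 1 of the reflection of \<open>v\<close> or of \<open>w\<close> in the opposite side of
  \<open>u v w\<close>. The same holds for \<open>v\<close> and \<open>w\<close> in place of \<open>u\<close>, so \<open>x\<close> is nearly within distance 1 of two
  of the three reflected vertices. Those are at distance 2 from each other, with the original
  vertices as midpoints, so \<open>x\<close> is near a vertex (\<open>three_caps\<close>).\<close>

section \<open>Weighted triples and symmetrization\<close>

definition triples :: "('a set \<Rightarrow> bool) \<Rightarrow> 'a set \<Rightarrow> 'a set set" where
  "triples R S = {T. T \<subseteq> S \<and> card T = 3 \<and> R T}"

text \<open>With all weights equal to 1 this counts the triples; a point of integer weight \<open>m\<close>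
  stands for a tight cluster of \<open>m\<close> points, of which a triple uses at most one.\<close>

definition weight :: "('a set \<Rightarrow> bool) \<Rightarrow> ('a \<Rightarrow> real) \<Rightarrow> 'a set \<Rightarrow> real" where
  "weight R x S = (\<Sum>T\<in>triples R S. \<Prod>p\<in>T. x p)"

lemma finite_triples: "finite S \<Longrightarrow> finite (triples R S)"
  by (rule finite_subset[of _ "Pow S"]) (auto simp: triples_def)

lemma finite_in_triples: "T \<in> triples R S \<Longrightarrow> finite T"
  by (auto simp: triples_def intro: card_ge_0_finite)

text \<open>The partial derivative of \<^term>\<open>weight R x S\<close> with respect to \<open>x i\<close>.\<close>

definition shift_coeff :: "('a set \<Rightarrow> bool) \<Rightarrow> ('a \<Rightarrow> real) \<Rightarrow> 'a set \<Rightarrow> 'a \<Rightarrow> real" where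
  "shift_coeff R x S i = (\<Sum>T\<in>{T \<in> triples R S. i \<in> T}. \<Prod>p\<in>T - {i}. x p)"

text \<open>The weight is multilinear, so it is affine in each single coordinate.\<close>

lemma weight_remove:
  assumes "finite S"
  shows "weight R x S = weight R x (S - {j}) + x j * shift_coeff R x S j"
proof -
  have split: "triples R S = triples R (S - {j}) \<union> {T \<in> triples R S. j \<in> T}"
    by (auto simp: triples_def)
  have "weight R x S = weight R x (S - {j}) + (\<Sum>T\<in>{T \<in> triples R S. j \<in> T}. \<Prod>p\<in>T. x p)"
    unfolding weight_def
    by (subst split, rule sum.union_disjoint)
       (use assms finite_triples in \<open>auto simp: triples_def\<close>)
  also have "(\<Sum>T\<in>{T \<in> triples R S. j \<in> T}. \<Prod>p\<in>T. x p) = x j * shift_coeff R x S j"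
    unfolding shift_coeff_def sum_distrib_left
    by (rule sum.cong) (auto dest: finite_in_triples intro: prod.remove)
  finally show ?thesis .
qed

text \<open>If no triple contains both \<open>i\<close> and \<open>j\<close>, then the weight has no term in \<open>x i * x j\<close>, so moving
  the mass of \<open>j\<close> onto \<open>i\<close> exchanges the contribution of \<open>j\<close> for the same multiple of the
  derivative at \<open>i\<close>. This is Zykov's symmetrization.\<close>

lemma weight_shift:
  assumes S: "finite S" and ij: "i \<noteq> j"
    and unc: "\<And>T. T \<in> triples R S \<Longrightarrow> \<not> (i \<in> T \<and> j \<in> T)"
  shows "weight R (x(i := x i + x j)) (S - {j}) = weight R x (S - {j}) + x j * shift_coeff R x S i"
proof -
  let ?y = "x(i := x i + x j)"
  have S': "finite (S - {j})" using S by simp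
  have eq: "{T \<in> triples R (S - {j}). i \<in> T} = {T \<in> triples R S. i \<in> T}"
    using unc by (auto simp: triples_def)
  have c1: "shift_coeff R x (S - {j}) i = shift_coeff R x S i"
    unfolding shift_coeff_def eq ..
  have c2: "shift_coeff R ?y (S - {j}) i = shift_coeff R x S i"
    unfolding shift_coeff_def eq by (intro sum.cong prod.cong) auto
  have w: "weight R ?y (S - {j} - {i}) = weight R x (S - {j} - {i})"
    unfolding weight_def by (intro sum.cong prod.cong) (auto simp: triples_def)
  show ?thesis
    using weight_remove[OF S', of R x i] weight_remove[OF S', of R ?y i]
    unfolding c1 c2 w by (simp add: algebra_simps)
qed

lemma inj_on_transversal:
  assumes "A \<inter> B = {}" "A \<inter> C = {}" "B \<inter> C = {}"
  shows "inj_on (\<lambda>(a, b, c). {a, b, c}) (A \<times> B \<times> C)"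
proof (rule inj_onI)
  fix s t assume st: "s \<in> A \<times> B \<times> C" "t \<in> A \<times> B \<times> C"
    and eq': "(case s of (a, b, c) \<Rightarrow> {a, b, c}) = (case t of (a, b, c) \<Rightarrow> {a, b, c})"
  obtain a b c where s: "s = (a, b, c)" by (cases s)
  obtain a' b' c' where t: "t = (a', b', c')" by (cases t)
  have mem: "a \<in> A" "b \<in> B" "c \<in> C" "a' \<in> A" "b' \<in> B" "c' \<in> C"
    using st unfolding s t by simp_all
  have eq: "{a, b, c} = {a', b', c'}" using eq' unfolding s t by simp
  have "{a, b, c} \<inter> A = {a}" "{a', b', c'} \<inter> A = {a'}"
    "{a, b, c} \<inter> B = {b}" "{a', b', c'} \<inter> B = {b'}"
    "{a, b, c} \<inter> C = {c}" "{a', b', c'} \<inter> C = {c'}"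
    using mem assms by auto
  then have "{a} = {a'}" "{b} = {b'}" "{c} = {c'}" unfolding eq by metis+
  then show "s = t" unfolding s t by simp
qed

lemma weight_split:
  fixes x :: "'a \<Rightarrow> real"
  assumes fin: "finite A" "finite B" "finite C"
    and disj: "A \<inter> B = {}" "A \<inter> C = {}" "B \<inter> C = {}"
    and nonneg: "\<And>p. 0 \<le> x p"
    and split: "\<And>T. T \<in> triples R (A \<union> B \<union> C) \<Longrightarrow>
      T \<subseteq> A \<or> T \<subseteq> B \<or> T \<subseteq> C \<or> (T \<inter> A \<noteq> {} \<and> T \<inter> B \<noteq> {} \<and> T \<inter> C \<noteq> {})"
  shows "weight R x (A \<union> B \<union> C) \<le>
    sum x A * sum x B * sum x C + weight R x A + weight R x B + weight R x C"
proof -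
  let ?f = "\<lambda>(a, b, c). {a, b, c}"
  let ?P = "A \<times> B \<times> C"
  let ?w = "\<lambda>T. \<Prod>p\<in>T. x p"
  have sub: "triples R (A \<union> B \<union> C) \<subseteq> ?f ` ?P \<union> triples R A \<union> triples R B \<union> triples R C"
  proof
    fix T assume T: "T \<in> triples R (A \<union> B \<union> C)"
    have "T \<in> ?f ` ?P" if "T \<inter> A \<noteq> {}" "T \<inter> B \<noteq> {}" "T \<inter> C \<noteq> {}"
    proof -
      from that obtain a b c where "a \<in> T \<inter> A" "b \<in> T \<inter> B" "c \<in> T \<inter> C"
        by (meson ex_in_conv)
      then have abc: "a \<in> T" "a \<in> A" "b \<in> T" "b \<in> B" "c \<in> T" "c \<in> C" by auto
      have "a \<noteq> b" "a \<noteq> c" "b \<noteq> c" using abc disj by auto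
      then have "card {a, b, c} = 3" by simp
      moreover have "card T = 3" using T by (simp add: triples_def)
      ultimately have "{a, b, c} = T"
        using abc finite_in_triples[OF T] by (intro card_subset_eq) auto
      then have "T = ?f (a, b, c)" by simp
      moreover have "(a, b, c) \<in> ?P" using abc by simp
      ultimately show ?thesis by (rule image_eqI)
    qed
    moreover have "T \<in> triples R X" if "T \<subseteq> X" for X
      using T that by (simp add: triples_def)
    ultimately show "T \<in> ?f ` ?P \<union> triples R A \<union> triples R B \<union> triples R C"
      using split[OF T] unfolding Un_iff by meson
  qed
  have nn: "0 \<le> ?w T" for T using nonneg by (simp add: prod_nonneg)
  have un: "sum ?w (M \<union> N) \<le> sum ?w M + sum ?w N" if "finite M" "finite N" for M N
    using sum.union_inter[OF that, of ?w] sum_nonneg[of "M \<inter> N" ?w, OF nn] by linarith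
  have fin': "finite (?f ` ?P)" "finite (triples R A)" "finite (triples R B)" "finite (triples R C)"
    using fin by (auto intro: finite_triples)
  have "inj_on ?f ?P" using disj by (rule inj_on_transversal)
  then have "sum ?w (?f ` ?P) = (\<Sum>(a, b, c)\<in>?P. ?w {a, b, c})"
    by (subst sum.reindex) (auto simp: case_prod_beta intro!: sum.cong)
  also have "\<dots> = (\<Sum>(a, b, c)\<in>?P. x a * (x b * x c))"
  proof (rule sum.cong, goal_cases)
    case (2 t)
    then obtain a b c where t: "t = (a, b, c)" "a \<in> A" "b \<in> B" "c \<in> C" by auto
    then have "a \<noteq> b" "a \<noteq> c" "b \<noteq> c" using disj by auto
    then show ?case using t by simp
  qed simp
  also have "\<dots> = sum x A * sum x B * sum x C"
  proof -
    have BC: "sum x B * sum x C = (\<Sum>t\<in>B \<times> C. x (fst t) * x (snd t))"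
      by (simp add: sum_product sum.cartesian_product case_prod_beta)
    have "sum x A * (sum x B * sum x C) = (\<Sum>t\<in>?P. x (fst t) * (x (fst (snd t)) * x (snd (snd t))))"
      unfolding BC by (simp add: sum_product sum.cartesian_product case_prod_beta)
    then show ?thesis by (simp add: case_prod_beta mult.assoc)
  qed
  finally have trans: "sum ?w (?f ` ?P) = sum x A * sum x B * sum x C" .
  have "weight R x (A \<union> B \<union> C) \<le> sum ?w (?f ` ?P \<union> triples R A \<union> triples R B \<union> triples R C)"
    unfolding weight_def using sub fin' nn by (intro sum_mono2) auto
  also have "\<dots> \<le> sum ?w (?f ` ?P) + sum ?w (triples R A) + sum ?w (triples R B) + sum ?w (triples R C)"
    using un[of "?f ` ?P" "triples R A"] un[of "?f ` ?P \<union> triples R A" "triples R B"]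
      un[of "?f ` ?P \<union> triples R A \<union> triples R B" "triples R C"] fin' by simp
  finally show ?thesis unfolding trans weight_def .
qed

text \<open>This is \<open>(a + b) * (b + c) * (c + a) \<ge> 8 * a * b * c\<close>, and it is why the constant is \<open>1/24\<close>:
  for \<open>a = b = c = 1/3\<close> it becomes the equation \<open>1/27 + 1/9 * (1/24) = 1/24\<close>.\<close>

lemma cube_split:
  fixes a b c :: real
  assumes "0 \<le> a" "0 \<le> b" "0 \<le> c"
  shows "a * b * c + a ^ 3 / 24 + b ^ 3 / 24 + c ^ 3 / 24 \<le> (a + b + c) ^ 3 / 24"
proof -
  have "0 \<le> a * (b - c)\<^sup>2 + b * (c - a)\<^sup>2 + c * (a - b)\<^sup>2"
    using assms by simp
  then show ?thesis by (simp add: power2_eq_square power3_eq_cube algebra_simps)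
qed

definition covered :: "('a set \<Rightarrow> bool) \<Rightarrow> 'a set \<Rightarrow> bool" where
  "covered R S \<longleftrightarrow> (\<forall>i\<in>S. \<forall>j\<in>S. i \<noteq> j \<longrightarrow> (\<exists>T\<in>triples R S. i \<in> T \<and> j \<in> T))"

definition splits :: "('a set \<Rightarrow> bool) \<Rightarrow> 'a set \<Rightarrow> bool" where
  "splits R S \<longleftrightarrow> (\<exists>A B C. S = A \<union> B \<union> C \<and> A \<noteq> {} \<and> B \<noteq> {} \<and> C \<noteq> {} \<and>
     A \<inter> B = {} \<and> A \<inter> C = {} \<and> B \<inter> C = {} \<and>
     (\<forall>T\<in>triples R S. T \<subseteq> A \<or> T \<subseteq> B \<or> T \<subseteq> C \<or>
        (T \<inter> A \<noteq> {} \<and> T \<inter> B \<noteq> {} \<and> T \<inter> C \<noteq> {})))"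

text \<open>Induction on the number of points. If a pair is not covered, move the mass of the point with
  the smaller derivative to the other one; the cubes only help, being superadditive. Otherwise
  split \<open>S\<close> into three parts and apply the induction hypothesis to each of them. The term with the
  cubes makes the bound homogeneous and keeps it sharp for one point; it accounts for
  the triples that the points inside a cluster could still form.\<close>

lemma weight_bound:
  fixes x :: "'a \<Rightarrow> real"
  assumes geo: "\<And>S. finite S \<Longrightarrow> 2 \<le> card S \<Longrightarrow> covered R S \<Longrightarrow> splits R S"
    and S: "finite S" and nonneg: "\<And>p. 0 \<le> x p"
  shows "weight R x S + (\<Sum>p\<in>S. x p ^ 3) / 24 \<le> (\<Sum>p\<in>S. x p) ^ 3 / 24"
  using S nonneg
proof (induction "card S" arbitrary: S x rule: less_induct)
  case less
  note fin = \<open>finite S\<close> and nn = \<open>\<And>p. 0 \<le> x p\<close>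
  consider "card S < 2" | "2 \<le> card S" "covered R S" | "\<not> covered R S" by linarith
  then show ?case
  proof cases
    case 1
    then have "card T \<noteq> 3" if "T \<subseteq> S" for T
      using card_mono[OF fin that] by linarith
    then have "triples R S = {}" by (auto simp: triples_def)
    then have "weight R x S = 0" by (simp add: weight_def)
    moreover have "S = {} \<or> (\<exists>s. S = {s})"
      using 1 fin by (metis One_nat_def Suc_1 card_0_eq card_1_singletonE less_2_cases)
    ultimately show ?thesis by auto
  next
    case 2
    from geo[OF fin 2] obtain A B C where ABC: "S = A \<union> B \<union> C" "A \<noteq> {}" "B \<noteq> {}" "C \<noteq> {}"
      "A \<inter> B = {}" "A \<inter> C = {}" "B \<inter> C = {}"
      and sp: "\<forall>T\<in>triples R S. T \<subseteq> A \<or> T \<subseteq> B \<or> T \<subseteq> C \<or>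
        (T \<inter> A \<noteq> {} \<and> T \<inter> B \<noteq> {} \<and> T \<inter> C \<noteq> {})"
      unfolding splits_def by - (elim exE conjE, rule that)
    have finABC: "finite A" "finite B" "finite C" using fin ABC by auto
    have sm: "card A < card S" "card B < card S" "card C < card S"
      using ABC fin by (auto intro!: psubset_card_mono)
    note IH = less.hyps[OF sm(1) finABC(1), of x, OF nn] less.hyps[OF sm(2) finABC(2), of x, OF nn]
      less.hyps[OF sm(3) finABC(3), of x, OF nn]
    have sums: "sum f S = sum f A + sum f B + sum f C" for f :: "'a \<Rightarrow> real"
      unfolding ABC(1) using ABC(5-7) finABC by (simp add: sum.union_disjoint Int_Un_distrib2)
    have "weight R x S \<le> sum x A * sum x B * sum x C + weight R x A + weight R x B + weight R x C"
      unfolding ABC(1) using finABC ABC(5-7) nn sp by (intro weight_split) (auto simp: ABC(1))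
    moreover have "sum x A * sum x B * sum x C + sum x A ^ 3 / 24 + sum x B ^ 3 / 24 + sum x C ^ 3 / 24
        \<le> (sum x A + sum x B + sum x C) ^ 3 / 24"
      by (intro cube_split sum_nonneg nn)
    ultimately show ?thesis
      using IH unfolding sums add_divide_distrib by linarith
  next
    case 3
    \<comment> \<open>all the mass of \<open>j\<close> goes to \<open>i\<close>, then the induction hypothesis applies without \<open>j\<close>\<close>
    have shift: ?thesis if ij: "i \<in> S" "j \<in> S" "i \<noteq> j"
      and unc: "\<And>T. T \<in> triples R S \<Longrightarrow> \<not> (i \<in> T \<and> j \<in> T)"
      and le: "shift_coeff R x S j \<le> shift_coeff R x S i" for i j
    proof -
      let ?y = "x(i := x i + x j)"
      let ?Q = "S - {i, j}"
      have S1: "S - {j} = insert i ?Q" "S = insert j (insert i ?Q)" using ij by auto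
      have Q: "finite ?Q" "i \<notin> ?Q" "j \<notin> insert i ?Q" using fin ij by auto
      have card: "card (S - {j}) < card S" using ij fin by (intro psubset_card_mono) auto
      have IH: "weight R ?y (S - {j}) + (\<Sum>p\<in>S - {j}. ?y p ^ 3) / 24 \<le> (\<Sum>p\<in>S - {j}. ?y p) ^ 3 / 24"
        using less.hyps[OF card, of ?y] fin nn by simp
      have yQ: "sum (\<lambda>p. ?y p ^ k) ?Q = sum (\<lambda>p. x p ^ k) ?Q" for k
        by (intro sum.cong) auto
      have lin: "sum ?y (S - {j}) = sum x S"
        using yQ[of 1] 
          sum.remove[OF fin \<open>j \<in> S\<close>, of x] sum.remove[of "S - {j}" i x] sum.remove[of "S - {j}" i ?y]
          fin ij by (simp add: Diff_insert2[symmetric] insert_commute)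
      have "(\<Sum>p\<in>S. x p ^ 3) = x j ^ 3 + x i ^ 3 + (\<Sum>p\<in>?Q. x p ^ 3)"
        using sum.insert[OF _ Q(3), of "\<lambda>p. x p ^ 3"] Q unfolding S1(2)[symmetric] by simp
      moreover have "(\<Sum>p\<in>S - {j}. ?y p ^ 3) = (x i + x j) ^ 3 + (\<Sum>p\<in>?Q. x p ^ 3)"
        unfolding S1(1) using Q yQ[of 3] by simp
      moreover have "x j ^ 3 + x i ^ 3 \<le> (x i + x j) ^ 3"
        using nn[of i] nn[of j] by (simp add: power3_eq_cube algebra_simps)
      ultimately have cub: "(\<Sum>p\<in>S. x p ^ 3) \<le> (\<Sum>p\<in>S - {j}. ?y p ^ 3)" by linarith
      have "weight R x S \<le> weight R ?y (S - {j})"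
        using weight_remove[OF fin, of R x j] weight_shift[where R = R and x = x, OF fin \<open>i \<noteq> j\<close> unc]
          mult_left_mono[OF le nn[of j]] by simp
      then show ?thesis using IH cub unfolding lin by linarith
    qed
    from 3 obtain i j where "i \<in> S" "j \<in> S" "i \<noteq> j"
      "\<And>T. T \<in> triples R S \<Longrightarrow> \<not> (i \<in> T \<and> j \<in> T)"
      unfolding covered_def by blast
    then show ?thesis
      using shift[of i j] shift[of j i] by (metis linorder_linear)
  qed
qed

section \<open>Nearly regular triangles in the complex plane\<close>

definition omega :: complex where "omega = Complex (1 / 2) (sqrt 3 / 2)"

lemma omega_square: "omega * omega = omega - 1"
  by (simp add: omega_def complex_eq_iff)

lemma norm_omega: "norm omega = 1" "norm (1 - omega) = 1"
  by (simp_all add: omega_def cmod_def power_divide)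

lemma sqrt3_bounds: "(1732 / 1000) \<le> sqrt 3" "sqrt 3 \<le> (17321 / 10000)"
  by (rule real_le_rsqrt real_le_lsqrt; simp add: power2_eq_square)+

text \<open>The numbers \<^term>\<open>omega\<close> and \<^term>\<open>1 - omega\<close> are the two primitive sixth roots of unity, so
  multiplication by them rotates by 60 degrees in the two directions. The apex \<open>c\<close> may lie on
  either side of the base \<open>a b\<close>. The tolerance \<open>1/40\<close> is what angles between 59 and 61 degrees
  guarantee, and the estimates for the caps below leave little room for a larger one.\<close>

definition near_regular :: "complex \<Rightarrow> complex \<Rightarrow> complex \<Rightarrow> bool" where
  "near_regular a b c \<longleftrightarrow>
     norm (c - a - omega * (b - a)) \<le> norm (b - a) / 40 \<or>
     norm (c - a - (1 - omega) * (b - a)) \<le> norm (b - a) / 40"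

text \<open>The hypotheses are the projection formulas for a triangle with sides \<open>a\<close>, \<open>b\<close>, \<open>c\<close> whose
  opposite angles have cosines \<open>ca\<close>, \<open>cb\<close>, \<open>cc\<close>. They replace the law of sines and the angle sum.\<close>

lemma side_diff:
  fixes a b c ca cb cc :: real
  assumes "c = a * cb + b * ca" "a = b * cc + c * cb" "b = a * cc + c * ca"
  shows "(a - b) * (1 + cc) = c * (cb - ca)"
proof -
  have "a - b = (b * cc + c * cb) - (a * cc + c * ca)" using assms(2,3) by simp
  then show ?thesis by (simp add: algebra_simps)
qed

lemma side_ratio:
  fixes a b c ca cb cc :: real
  assumes "c = a * cb + b * ca" "a = b * cc + c * cb" "b = a * cc + c * ca"
    and "0 < c" "\<bar>ca - 1/2\<bar> \<le> (152 / 10000)" "\<bar>cb - 1/2\<bar> \<le> (152 / 10000)" "\<bar>cc - 1/2\<bar> \<le> (152 / 10000)"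
  shows "\<bar>a - b\<bar> \<le> (205 / 10000) * c"
proof -
  have pos: "0 < 1 + cc" using assms(7) by linarith
  have "\<bar>a - b\<bar> * (1 + cc) = c * \<bar>cb - ca\<bar>"
    using arg_cong[OF side_diff[OF assms(1-3)], of abs] \<open>0 < c\<close> pos by (simp add: abs_mult)
  also have "\<dots> \<le> c * (304 / 10000)"
  proof (rule mult_left_mono)
    show "\<bar>cb - ca\<bar> \<le> 304 / 10000" using assms(5,6) unfolding abs_le_iff by linarith
  qed (use \<open>0 < c\<close> in simp)
  finally have 1: "\<bar>a - b\<bar> * (1 + cc) \<le> c * (304 / 10000)" .
  have "\<bar>a - b\<bar> * (14848 / 10000) \<le> \<bar>a - b\<bar> * (1 + cc)"
    using assms(7) unfolding abs_le_iff by (intro mult_left_mono) auto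
  then show ?thesis using 1 \<open>0 < c\<close> by simp
qed

text \<open>Put \<open>d = z - omega\<close>. To first order, the three hypotheses bound the components of \<open>d\<close> along three
  directions that are 60 degrees apart, which confines \<open>d\<close> to a hexagon of inradius about
  \<open>0.0216\<close> and circumradius below \<open>1/40\<close>. A rough bound on \<open>d\<close> is needed first to control the
  quadratic terms.\<close>

lemma near_omega:
  fixes z :: complex
  assumes z: "\<bar>norm z - norm (z - 1)\<bar> \<le> (205 / 10000)" "\<bar>norm z - 1\<bar> \<le> (205 / 10000) * norm (z - 1)"
    "\<bar>norm (z - 1) - 1\<bar> \<le> (205 / 10000) * norm z" and im: "0 \<le> Im z"
  shows "norm (z - omega) \<le> 1 / 40"
proof -
  define k l where "k = norm z" and "l = norm (z - 1)"
  define x y where "x = Re z - 1/2" and "y = Im z - sqrt 3 / 2"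
  have z': "\<bar>k - l\<bar> \<le> (205 / 10000)" "k - 1 \<le> (205 / 10000) * l" "l - 1 \<le> (205 / 10000) * k"
      "1 - k \<le> (205 / 10000) * l" "1 - l \<le> (205 / 10000) * k"
    using z unfolding k_def l_def abs_le_iff by linarith+
  then have kl_le: "k \<le> (102094 / 100000)" "l \<le> (102094 / 100000)" by linarith+
  have kl: "\<bar>k - l\<bar> \<le> (205 / 10000)" "\<bar>k - 1\<bar> \<le> (2094 / 100000)" "\<bar>l - 1\<bar> \<le> (2094 / 100000)"
    using z' kl_le unfolding abs_le_iff by linarith+
  have re: "Re z = x + 1 / 2" and im': "Im z = y + sqrt 3 / 2" by (simp_all add: x_def y_def)
  have "k\<^sup>2 = (Re z)\<^sup>2 + (Im z)\<^sup>2" by (simp add: k_def cmod_power2)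
  then have k2: "k\<^sup>2 = 1 + x + sqrt 3 * y + (x\<^sup>2 + y\<^sup>2)"
    unfolding re im' by (simp add: power2_sum power_divide algebra_simps)
  have "l\<^sup>2 = (Re z - 1)\<^sup>2 + (Im z)\<^sup>2" by (simp add: l_def cmod_power2)
  then have l2: "l\<^sup>2 = 1 - x + sqrt 3 * y + (x\<^sup>2 + y\<^sup>2)"
    unfolding re im' by (simp add: power2_sum power2_diff power_divide algebra_simps)
  have sq: "t\<^sup>2 \<le> 10424 / 10000 \<and> 9585 / 10000 \<le> t\<^sup>2" if "\<bar>t - 1\<bar> \<le> 2094 / 100000" for t :: real
  proof -
    have t: "97906 / 100000 \<le> t" "t \<le> 102094 / 100000" using that unfolding abs_le_iff by linarith+
    have "t\<^sup>2 \<le> (102094 / 100000)\<^sup>2" "(97906 / 100000)\<^sup>2 \<le> t\<^sup>2" using t by (intro power_mono; simp)+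
    then show ?thesis by (simp add: power2_eq_square)
  qed
  have kb: "k\<^sup>2 \<le> 10424 / 10000" "9585 / 10000 \<le> k\<^sup>2" "l\<^sup>2 \<le> 10424 / 10000" "9585 / 10000 \<le> l\<^sup>2"
    using sq[OF kl(2)] sq[OF kl(3)] by blast+
  have sum_le: "\<bar>k + l\<bar> \<le> 20419 / 10000" using kl_le kl unfolding abs_le_iff by linarith
  have "2 * x = (k - l) * (k + l)" using k2 l2 by (simp add: power2_eq_square algebra_simps)
  also have "\<bar>\<dots>\<bar> \<le> (205 / 10000) * (20419 / 10000)"
    unfolding abs_mult using kl(1) sum_le by (intro mult_mono) auto
  finally have x: "\<bar>x\<bar> \<le> (2093 / 100000)" by simp
  have x2: "x\<^sup>2 \<le> (44 / 100000)"
    using power_mono[of "\<bar>x\<bar>" "(2093 / 100000)" 2] x by (simp add: power2_eq_square)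
  have s: "k\<^sup>2 + l\<^sup>2 = 2 + 2 * (sqrt 3 * y) + 2 * x\<^sup>2 + 2 * y\<^sup>2" using k2 l2 by simp
  have ylow: "- (sqrt 3 / 2) \<le> y" using im y_def by simp
  have "sqrt 3 * y + y\<^sup>2 = y * (y + sqrt 3)" by (simp add: power2_eq_square algebra_simps)
  then have yb: "y * (y + sqrt 3) \<le> (424 / 10000)" "- (42 / 1000) \<le> y * (y + sqrt 3)"
    using s kb x2 zero_le_power2[of x] by linarith+
  have ys: "(866 / 1000) \<le> y + sqrt 3" using ylow sqrt3_bounds by linarith
  have y: "\<bar>y\<bar> \<le> (5 / 100)"
  proof -
    have "\<bar>y\<bar> * (866 / 1000) \<le> \<bar>y\<bar> * (y + sqrt 3)" using ys by (intro mult_left_mono) auto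
    also have "\<dots> = \<bar>y * (y + sqrt 3)\<bar>" using ys by (simp add: abs_mult)
    finally show ?thesis using yb by linarith
  qed
  have y2: "y\<^sup>2 \<le> (12 / 10000)"
  proof -
    have ys: "(168 / 100) \<le> y + sqrt 3" using y sqrt3_bounds by linarith
    have "\<bar>y\<bar> * (168 / 100) \<le> \<bar>y\<bar> * (y + sqrt 3)" using ys by (intro mult_left_mono) auto
    also have "\<dots> = \<bar>y * (y + sqrt 3)\<bar>" using ys by (simp add: abs_mult)
    finally have "\<bar>y\<bar> \<le> (26 / 1000)" using yb by linarith
    then show ?thesis using power_mono[of "\<bar>y\<bar>" "(26 / 1000)" 2] by (simp add: power2_eq_square)
  qed
  \<comment> \<open>\<open>p\<close> and \<open>q\<close> are the components of \<open>d = x + i y\<close> along \<open>omega\<close> and \<open>omega - 1\<close>, the third one is \<open>p - q\<close>\<close>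
  define p q where "p = (x + sqrt 3 * y) / 2" and "q = (sqrt 3 * y - x) / 2"
  have pq: "\<bar>p\<bar> \<le> (216 / 10000)" "\<bar>q\<bar> \<le> (216 / 10000)" "\<bar>p - q\<bar> \<le> (216 / 10000)"
  proof -
    have "2 * p = k\<^sup>2 - 1 - (x\<^sup>2 + y\<^sup>2)" "2 * q = l\<^sup>2 - 1 - (x\<^sup>2 + y\<^sup>2)" "p - q = x"
      unfolding k2 l2 by (simp_all add: p_def q_def field_simps)
    then show "\<bar>p\<bar> \<le> 216 / 10000" "\<bar>q\<bar> \<le> 216 / 10000" "\<bar>p - q\<bar> \<le> 216 / 10000"
      using kb x x2 y2 zero_le_power2[of x] zero_le_power2[of y] unfolding abs_le_iff by linarith+
  qed
  have "p\<^sup>2 - p * q + q\<^sup>2 \<le> (216 / 10000)\<^sup>2"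
  proof (cases "0 \<le> p * q")
    case True
    have "p\<^sup>2 - p * q + q\<^sup>2 \<le> (max \<bar>p\<bar> \<bar>q\<bar>)\<^sup>2"
    proof (cases "\<bar>p\<bar> \<le> \<bar>q\<bar>")
      case True
      then have "\<bar>p\<bar> * \<bar>p\<bar> \<le> \<bar>p\<bar> * \<bar>q\<bar>" by (intro mult_left_mono) auto
      then have "p\<^sup>2 \<le> p * q" using \<open>0 \<le> p * q\<close> by (simp add: power2_eq_square abs_mult[symmetric])
      then show ?thesis using True by (simp add: max_def)
    next
      case False
      then have "\<bar>q\<bar> * \<bar>q\<bar> \<le> \<bar>p\<bar> * \<bar>q\<bar>" by (intro mult_right_mono) auto
      then have "q\<^sup>2 \<le> p * q" using \<open>0 \<le> p * q\<close> by (simp add: power2_eq_square abs_mult[symmetric])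
      then show ?thesis using False by (simp add: max_def)
    qed
    also have "\<dots> \<le> (216 / 10000)\<^sup>2" using pq by (intro power_mono) auto
    finally show ?thesis .
  next
    case False
    then have "p\<^sup>2 - p * q + q\<^sup>2 \<le> \<bar>p - q\<bar>\<^sup>2" by (simp add: power2_diff)
    also have "\<dots> \<le> (216 / 10000)\<^sup>2" using pq by (intro power_mono) auto
    finally show ?thesis .
  qed
  moreover have "x\<^sup>2 + y\<^sup>2 = 4/3 * (p\<^sup>2 - p * q + q\<^sup>2)"
  proof -
    have "4/3 * (p\<^sup>2 - p * q + q\<^sup>2) = x\<^sup>2 + (sqrt 3 * y)\<^sup>2 / 3"
      unfolding p_def q_def by (simp only: power2_eq_square) (simp add: field_simps)
    then show ?thesis by (simp add: power_mult_distrib)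
  qed
  moreover have "4/3 * (216 / 10000)\<^sup>2 \<le> (1/40 :: real)\<^sup>2" by (simp add: power2_eq_square)
  ultimately have "x\<^sup>2 + y\<^sup>2 \<le> (1/40)\<^sup>2"
    using mult_left_mono[of "p\<^sup>2 - p * q + q\<^sup>2" "(216 / 10000)\<^sup>2" "4/3"] by linarith
  moreover have "(norm (z - omega))\<^sup>2 = x\<^sup>2 + y\<^sup>2"
    by (simp add: cmod_power2 omega_def x_def y_def)
  ultimately have "(norm (z - omega))\<^sup>2 \<le> (1/40)\<^sup>2" by metis
  then show ?thesis by (rule power2_le_imp_le) simp
qed

section \<open>Clusters at the corners of a largest triangle\<close>

text \<open>The rotation by 120 degrees about the centre of the triangle \<open>0\<close>, \<open>1\<close>, \<^term>\<open>omega\<close>. It carries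
  statements about the corner \<^term>\<open>omega\<close> to the other two corners.\<close>

definition rot :: "complex \<Rightarrow> complex" where "rot z = 1 + (omega - 1) * z"

lemma norm_rot_diff: "norm (rot x - rot y) = norm (x - y)"
proof -
  have "rot x - rot y = (omega - 1) * (x - y)" by (simp add: rot_def algebra_simps)
  then show ?thesis using norm_omega(2) by (simp add: norm_mult norm_minus_commute)
qed

lemma rot_values:
  "rot 0 = 1" "rot 1 = omega" "rot omega = 0"
  "rot (1 - omega) = 1 + omega" "rot (1 + omega) = omega - 1" "rot (omega - 1) = 1 - omega"
  by (simp_all add: rot_def algebra_simps omega_square)

lemma rot_rot_rot: "rot (rot (rot z)) = z"
proof -
  have "(omega - 1) * ((omega - 1) * (omega - 1)) = 1"
    by (simp add: algebra_simps omega_square)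
  then have "(omega - 1) * ((omega - 1) * ((omega - 1) * z)) = z"
    by (simp flip: mult.assoc)
  moreover have "rot (rot (rot z)) =
    1 + (omega - 1) + (omega - 1) * (omega - 1) + (omega - 1) * ((omega - 1) * ((omega - 1) * z))"
    by (simp add: rot_def ring_distribs)
  moreover have "1 + (omega - 1) + (omega - 1) * (omega - 1) = 0"
    by (simp add: algebra_simps omega_square)
  ultimately show ?thesis by simp
qed

text \<open>A box below \<^term>\<open>omega\<close> that contains all points of the configuration near that corner. A point
  \<open>z\<close> is near the corner \<open>1\<close> if \<open>cap (rot z)\<close>, and near the corner \<open>0\<close> if \<open>cap (rot (rot z))\<close>.\<close>

definition cap :: "complex \<Rightarrow> bool" where
  "cap z \<longleftrightarrow> \<bar>Re z - 1/2\<bar> \<le> 1/20 \<and> - 3203/10000 \<le> Im z - sqrt 3 / 2 \<and> Im z - sqrt 3 / 2 \<le> 3/100"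

text \<open>The points \<^term>\<open>1 + omega\<close> and \<^term>\<open>omega - 1\<close> are at distance 2 with midpoint
  \<^term>\<open>omega\<close>, so two discs of radius slightly more than 1 around them meet in a thin lens. The
  discs around \<open>0\<close> and \<open>1\<close> cut off the upper half of the lens.\<close>

lemma cap_of_dist:
  assumes "norm (x - (1 + omega)) \<le> 21/20" "norm (x - (omega - 1)) \<le> 21/20"
    and "norm x \<le> 41/40" "norm (x - 1) \<le> 41/40"
  shows "cap x"
proof -
  define p q where "p = Re x - 1/2" and "q = Im x - sqrt 3 / 2"
  have pq: "Re x = p + 1/2" "Im x = q + sqrt 3 / 2" by (simp_all add: p_def q_def)
  have sq: "(norm z)\<^sup>2 \<le> r\<^sup>2" if "norm z \<le> r" for z :: complex and r
    using that by (intro power_mono) auto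
  have "(norm (x - (1 + omega)))\<^sup>2 = (p - 1)\<^sup>2 + q\<^sup>2"
    unfolding cmod_power2 by (simp add: omega_def pq)
  then have 1: "(p - 1)\<^sup>2 + q\<^sup>2 \<le> 441/400" using sq[OF assms(1)] by (simp add: power2_eq_square)
  have "(norm (x - (omega - 1)))\<^sup>2 = (p + 1)\<^sup>2 + q\<^sup>2"
    unfolding cmod_power2 by (simp add: omega_def pq add.commute)
  then have 2: "(p + 1)\<^sup>2 + q\<^sup>2 \<le> 441/400" using sq[OF assms(2)] by (simp add: power2_eq_square)
  have "(norm x)\<^sup>2 = p\<^sup>2 + q\<^sup>2 + p + sqrt 3 * q + 1"
    unfolding cmod_power2 by (simp add: pq power2_sum power_divide algebra_simps)
  then have 3: "p\<^sup>2 + q\<^sup>2 + p + sqrt 3 * q + 1 \<le> 1681/1600"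
    using sq[OF assms(3)] by (simp add: power2_eq_square)
  have "(norm (x - 1))\<^sup>2 = p\<^sup>2 + q\<^sup>2 - p + sqrt 3 * q + 1"
    unfolding cmod_power2 by (simp add: pq power2_sum power2_diff power_divide algebra_simps)
  then have 4: "p\<^sup>2 + q\<^sup>2 - p + sqrt 3 * q + 1 \<le> 1681/1600"
    using sq[OF assms(4)] by (simp add: power2_eq_square)
  have e: "(21/20 :: real)\<^sup>2 = 441/400" by (simp add: power2_eq_square)
  have h: "(1 - p)\<^sup>2 \<le> (21/20)\<^sup>2" "(p + 1)\<^sup>2 \<le> (21/20)\<^sup>2"
    using 1 2 zero_le_power2[of q] power2_commute[of 1 p] unfolding e by linarith+
  have "1 - p \<le> 21/20" "p + 1 \<le> 21/20"
    using h[THEN power2_le_imp_le] by simp_all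
  then have p: "\<bar>p\<bar> \<le> 1/20" by linarith
  have "(p - 1)\<^sup>2 + (p + 1)\<^sup>2 = 2 * p\<^sup>2 + 2" by (simp add: power2_eq_square algebra_simps)
  then have "q\<^sup>2 \<le> 41/400" using 1 2 zero_le_power2[of p] by linarith
  also have "\<dots> \<le> (3203/10000)\<^sup>2" by (simp add: power2_eq_square)
  finally have "\<bar>q\<bar> \<le> 3203/10000" by (simp only: abs_le_square_iff[symmetric] abs_of_pos)
  moreover have "sqrt 3 * q \<le> 81/1600" using 3 4 zero_le_power2[of p] zero_le_power2[of q] by linarith
  then have "q \<le> 3/100"
    using mult_right_mono[OF sqrt3_bounds(1), of q] by (cases "0 \<le> q") auto
  ultimately have "- 3203/10000 \<le> q" "q \<le> 3/100" unfolding abs_le_iff by linarith+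
  then show ?thesis using p unfolding cap_def p_def[symmetric] q_def[symmetric] by blast
qed

lemma cap_diam:
  assumes "cap x" "cap y"
  shows "norm (x - y) \<le> 365/1000"
proof -
  have "\<bar>Re (x - y)\<bar> \<le> 1/10" "\<bar>Im (x - y)\<bar> \<le> 3503/10000"
    using assms unfolding cap_def abs_le_iff minus_complex.sel by linarith+
  then have "\<bar>Re (x - y)\<bar>\<^sup>2 \<le> (1/10)\<^sup>2" "\<bar>Im (x - y)\<bar>\<^sup>2 \<le> (3503/10000)\<^sup>2"
    by (intro power_mono; simp)+
  then have "(norm (x - y))\<^sup>2 \<le> (365/1000)\<^sup>2"
    unfolding cmod_power2 by (simp add: power2_eq_square)
  then show ?thesis by (rule power2_le_imp_le) simp
qed

text \<open>Project \<open>x - y\<close> to the direction \<open>omega - 1\<close> of the side that joins the two corners. The bound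
  exceeds \<open>41/40 * 365/1000\<close>, the longest side that a nearly regular triangle with one side inside a
  single cap can have.\<close>

lemma cap_sep:
  assumes "cap x" "cap (rot y)"
  shows "39/100 \<le> norm (x - y)"
proof -
  define p q where "p = Re x - 1/2" and "q = Im x - sqrt 3 / 2"
  define p' q' where "p' = Re (rot y) - 1/2" and "q' = Im (rot y) - sqrt 3 / 2"
  have b: "\<bar>p\<bar> \<le> 1/20" "\<bar>p'\<bar> \<le> 1/20" "- 3203/10000 \<le> q" "- 3203/10000 \<le> q'"
    using assms unfolding cap_def p_def q_def p'_def q'_def by auto
  have s3: "sqrt 3 * (sqrt 3 * t) = 3 * t" for t by (simp flip: mult.assoc)
  have "Re ((x - y) * (- omega)) = 1 - p / 2 + p' / 2 + sqrt 3 / 2 * (q + q')"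
    unfolding p_def q_def p'_def q'_def rot_def omega_def by (simp add: field_simps s3)
  moreover have "Re ((x - y) * (- omega)) \<le> norm (x - y)"
    using complex_Re_le_cmod[of "(x - y) * (- omega)"] norm_omega(1) by (simp add: norm_mult)
  moreover have "sqrt 3 / 2 * (- (q + q')) \<le> 17321 / 20000 * (6406 / 10000)"
  proof (cases "0 \<le> - (q + q')")
    case True
    then show ?thesis using sqrt3_bounds b by (intro mult_mono) auto
  next
    case False
    then have "sqrt 3 / 2 * (- (q + q')) \<le> 0" by (intro mult_nonneg_nonpos) auto
    then show ?thesis by (rule order.trans) simp
  qed
  moreover have "sqrt 3 / 2 * (- (q + q')) = - (sqrt 3 / 2 * (q + q'))" by (simp add: algebra_simps)
  ultimately show ?thesis using b unfolding abs_le_iff by linarith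
qed

lemma near_regular_dist:
  assumes "near_regular a b c"
  shows "norm (c - a) \<le> 41/40 * norm (b - a)"
proof -
  have "norm (c - a) \<le> norm (c - a - t * (b - a)) + norm t * norm (b - a)" for t
    using norm_triangle_ineq[of "c - a - t * (b - a)" "t * (b - a)"] by (simp add: norm_mult)
  from this[of omega] this[of "1 - omega"] show ?thesis
    using assms norm_omega unfolding near_regular_def by auto
qed

text \<open>The third vertex \<open>c\<close> is nearly the image of \<open>b\<close> under one of the two rotations by 60 degrees
  about \<open>a\<close>. These rotations take \<open>s'\<close> to \<open>s\<close> and \<open>t'\<close> to \<open>t\<close>, nearly; since \<open>c\<close> is within
  distance 1 of \<open>s\<close> and \<open>t\<close>, rotating back puts \<open>b\<close> close to the disc around \<open>s'\<close> or \<open>t'\<close>.\<close>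

lemma corner_test:
  assumes near: "near_regular a b c" and ab: "norm (b - a) \<le> 1"
    and c: "norm (c - s) \<le> 1" "norm (c - t) \<le> 1"
    and s': "norm (a + omega * (s' - a) - s) \<le> 1/40"
    and t': "norm (a + (1 - omega) * (t' - a) - t) \<le> 1/40"
  shows "norm (b - s') \<le> 21/20 \<or> norm (b - t') \<le> 21/20"
proof -
  have *: "norm (b - r') \<le> 21/20"
    if r: "norm r = 1" "norm (c - a - r * (b - a)) \<le> norm (b - a) / 40"
      "norm (c - d) \<le> 1" "norm (a + r * (r' - a) - d) \<le> 1/40" for r r' d
  proof -
    have eq: "r * (b - r') = (c - d) - (c - a - r * (b - a)) - (a + r * (r' - a) - d)"
      by (simp add: algebra_simps)
    have "norm (r * (b - r')) \<le> norm (c - d) + norm (c - a - r * (b - a)) + norm (a + r * (r' - a) - d)"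
      unfolding eq using norm_triangle_ineq4[of "(c - d) - (c - a - r * (b - a))" "a + r * (r' - a) - d"]
        norm_triangle_ineq4[of "c - d" "c - a - r * (b - a)"] by linarith
    then show ?thesis using r ab by (simp add: norm_mult)
  qed
  show ?thesis
    using near c s' t' norm_omega *[of omega s s'] *[of "1 - omega" t t']
    unfolding near_regular_def by blast
qed

text \<open>Let \<open>u'\<close>, \<open>v'\<close>, \<open>w'\<close> be the reflections of the corners \<open>0\<close>, \<open>1\<close>, \<^term>\<open>omega\<close> in the opposite
  sides, that is, \<^term>\<open>1 + omega\<close>, \<^term>\<open>omega - 1\<close> and \<^term>\<open>1 - omega\<close>. Completing \<open>x\<close> and one
  corner to a triangle inside the set shows that \<open>x\<close> is within \<open>21/20\<close> of one of the reflections of the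
  other two corners. Doing this for all three corners, \<open>x\<close> is close to two of \<open>u'\<close>, \<open>v'\<close>, \<open>w'\<close>,
  and the corners are the midpoints of those pairs.\<close>

lemma three_caps:
  assumes S: "0 \<in> S" "1 \<in> S" "w \<in> S" "norm (w - omega) \<le> 1/40"
    and diam: "\<And>x y. x \<in> S \<Longrightarrow> y \<in> S \<Longrightarrow> norm (x - y) \<le> 1"
    and cov: "\<And>x y. x \<in> S \<Longrightarrow> y \<in> S \<Longrightarrow> x \<noteq> y \<Longrightarrow> \<exists>t\<in>S. near_regular x y t"
    and x: "x \<in> S"
  shows "cap x \<or> cap (rot x) \<or> cap (rot (rot x))"
proof -
  have capI: "cap x" if "norm (x - (1 + omega)) \<le> 21/20" "norm (x - (omega - 1)) \<le> 21/20"
    "norm (x - 0) \<le> 41/40" "norm (x - 1) \<le> 41/40" for x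
    using cap_of_dist that by simp
  have d: "norm (x - 0) \<le> 41/40" "norm (x - 1) \<le> 41/40" "norm (x - omega) \<le> 41/40"
    using diam[OF x S(1)] diam[OF x S(2)] diam[OF x S(3)] S(4)
      norm_triangle_ineq[of "x - w" "w - omega"] by simp_all
  have nw: "norm (omega - w) \<le> 1/40" using S(4) by (simp add: norm_minus_commute)
  have 0: "norm (x - (1 - omega)) \<le> 21/20 \<or> norm (x - (omega - 1)) \<le> 21/20"
  proof (cases "x = 0")
    case False
    then obtain t where t: "t \<in> S" "near_regular 0 x t" using cov[OF S(1) x] by auto
    have e: "0 + omega * (1 - omega - 0) - 1 = 0" "0 + (1 - omega) * (omega - 1 - 0) - w = omega - w"
      by (simp_all add: algebra_simps omega_square)
    show ?thesis
      using corner_test[OF t(2) diam[OF x S(1)] diam[OF t(1) S(2)] diam[OF t(1) S(3)],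
          of "1 - omega" "omega - 1"] nw unfolding e by simp
  qed (use norm_omega in simp)
  have 1: "norm (x - (1 + omega)) \<le> 21/20 \<or> norm (x - (1 - omega)) \<le> 21/20"
  proof (cases "x = 1")
    case False
    then obtain t where t: "t \<in> S" "near_regular 1 x t" using cov[OF S(2) x] by auto
    have e: "1 + omega * (1 + omega - 1) - w = omega - w" "1 + (1 - omega) * (1 - omega - 1) - 0 = 0"
      by (simp_all add: algebra_simps omega_square)
    show ?thesis
      using corner_test[OF t(2) diam[OF x S(2)] diam[OF t(1) S(3)] diam[OF t(1) S(1)],
          of "1 + omega" "1 - omega"] nw unfolding e by simp
  qed (use norm_omega in simp)
  have 2: "norm (x - (omega - 1)) \<le> 21/20 \<or> norm (x - (1 + omega)) \<le> 21/20"
  proof (cases "x = w")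
    case False
    then obtain t where t: "t \<in> S" "near_regular w x t" using cov[OF S(3) x] by auto
    have e: "w + omega * (omega - 1 - w) - 0 = (1 - omega) * (w - omega)"
      "w + (1 - omega) * (1 + omega - w) - 1 = omega * (w - omega)"
      by (simp_all add: algebra_simps omega_square)
    show ?thesis
      using corner_test[OF t(2) diam[OF x S(3)] diam[OF t(1) S(1)] diam[OF t(1) S(2)],
          of "omega - 1" "1 + omega"] S(4) norm_omega unfolding e by (simp add: norm_mult)
  next
    case True
    have "norm (w - (omega - 1)) \<le> norm (w - omega) + norm (1::complex)"
      using norm_triangle_ineq[of "w - omega" 1] by (simp add: algebra_simps)
    then show ?thesis using True S(4) by simp
  qed
  have r: "norm (rot x - rot z) = norm (x - z)" "norm (rot (rot x) - rot (rot z)) = norm (x - z)" for z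
    by (simp_all add: norm_rot_diff)
  have "cap x" if "norm (x - (1 + omega)) \<le> 21/20" "norm (x - (omega - 1)) \<le> 21/20"
    using that d by (intro capI)
  moreover have "cap (rot x)" if "norm (x - (1 + omega)) \<le> 21/20" "norm (x - (1 - omega)) \<le> 21/20"
    using that d r(1)[of "1 - omega"] r(1)[of "1 + omega"] r(1)[of omega] r(1)[of 0]
    by (intro capI) (simp_all add: rot_values)
  moreover have "cap (rot (rot x))" if "norm (x - (omega - 1)) \<le> 21/20" "norm (x - (1 - omega)) \<le> 21/20"
    using that d r(2)[of "1 - omega"] r(2)[of "omega - 1"] r(2)[of omega] r(2)[of 1]
    by (intro capI) (simp_all add: rot_values)
  ultimately show ?thesis using 0 1 2 by blast
qed

section \<open>From angles to the complex plane, and the upper bound\<close>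

definition cx :: "real^2 \<Rightarrow> complex" where "cx x = Complex (x $ 1) (x $ 2)"

lemma cx_diff: "cx x - cx y = cx (x - y)"
  by (simp add: cx_def complex_eq_iff)

lemma norm_cx: "norm (cx x) = norm x"
  by (simp add: cx_def cmod_def norm_vec_def L2_set_def sum_2)

lemma cx_inject: "cx x = cx y \<longleftrightarrow> x = y"
  by (simp add: cx_def vec_eq_iff forall_2)

text \<open>The extreme deviation is \<open>1/2 - cos 61 = 0.01519\<dots>\<close>, in degrees.\<close>

lemma cos_bound:
  assumes "\<bar>t - pi / 3\<bar> \<le> pi / 180"
  shows "\<bar>cos t - 1/2\<bar> \<le> 152/10000"
proof -
  define s where "s = t - pi / 3"
  have pi: "pi / 180 \<le> 17454 / 1000000" using pi_approx(2) by simp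
  have s: "\<bar>s\<bar> \<le> 17454 / 1000000" using assms pi unfolding s_def by linarith
  have "cos t = cos (s + pi / 3)" by (simp add: s_def)
  also have "\<dots> = cos s / 2 - sin s * (sqrt 3 / 2)" by (simp add: cos_add cos_60 sin_60)
  finally have c: "cos t = cos s / 2 - sin s * (sqrt 3 / 2)" .
  have "\<bar>sin s * (sqrt 3 / 2)\<bar> \<le> 17454 / 1000000 * (17321 / 20000)"
    unfolding abs_mult using abs_sin_x_le_abs_x[of s] s sqrt3_bounds by (intro mult_mono) auto
  moreover have "1 - cos s \<le> 154 / 1000000"
  proof -
    have "1 - cos s = 2 * (sin (s / 2))\<^sup>2" using cos_double_sin[of "s / 2"] by simp
    also have "(sin (s / 2))\<^sup>2 = \<bar>sin (s / 2)\<bar>\<^sup>2" by simp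
    also have "\<dots> \<le> (8727 / 1000000)\<^sup>2"
      using abs_sin_x_le_abs_x[of "s / 2"] s by (intro power_mono) auto
    finally show ?thesis by (simp add: power2_eq_square)
  qed
  ultimately show ?thesis using cos_le_one[of s] unfolding c abs_le_iff by linarith
qed

definition cos_angle :: "real^2 \<Rightarrow> real^2 \<Rightarrow> real^2 \<Rightarrow> real" where
  "cos_angle a b c = inner (a - b) (c - b) / (norm (a - b) * norm (c - b))"

lemma abs_cos_angle: "\<bar>cos_angle a b c\<bar> \<le> 1"
  using Cauchy_Schwarz_ineq2[of "a - b" "c - b"]
  by (cases "norm (a - b) * norm (c - b) = 0") (auto simp: cos_angle_def divide_le_eq abs_mult)

lemma cos_angle_commute: "cos_angle a b c = cos_angle c b a"
  by (simp add: cos_angle_def inner_commute mult.commute)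

lemma cos_angle_bound:
  assumes "59 < angle_deg a b c" "angle_deg a b c < 61"
  shows "\<bar>cos_angle a b c - 1/2\<bar> \<le> 152/10000"
proof -
  define t where "t = arccos (cos_angle a b c)"
  have "cos t = cos_angle a b c"
    using abs_cos_angle[of a b c] by (simp add: t_def cos_arccos abs_le_iff)
  moreover have "59 < t * (180 / pi)" "t * (180 / pi) < 61"
    using assms by (simp_all add: angle_deg_def t_def cos_angle_def)
  then have "59 * pi / 180 < t" "t < 61 * pi / 180" by (simp_all add: field_simps)
  then have "\<bar>t - pi / 3\<bar> \<le> pi / 180" unfolding abs_le_iff by simp
  ultimately show ?thesis using cos_bound[of t] by simp
qed

text \<open>The foot of the altitude from \<open>c\<close> splits the side \<open>a b\<close>.\<close>

lemma projection:
  assumes "a \<noteq> b"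
  shows "norm (a - b) = norm (a - c) * cos_angle b a c + norm (b - c) * cos_angle a b c"
proof -
  have 1: "inner (x - y) (z - y) = norm (x - y) * norm (z - y) * cos_angle x y z" for x y z
    by (cases "x = y \<or> z = y") (auto simp: cos_angle_def)
  have "norm (a - b) * norm (a - b) = inner (b - a) (c - a) + inner (a - b) (c - b)"
    by (simp flip: power2_norm_eq_inner power2_eq_square add: inner_diff inner_commute)
       (simp add: power2_norm_eq_inner inner_diff inner_commute)
  also have "\<dots> = norm (a - b) * (norm (a - c) * cos_angle b a c + norm (b - c) * cos_angle a b c)"
    unfolding 1 by (simp add: norm_minus_commute algebra_simps)
  finally show ?thesis using assms by simp
qed

lemma near_regular_if_almost_regular:
  assumes T: "almost_regular T" and mem: "a \<in> T" "b \<in> T" "c \<in> T" and ne: "a \<noteq> b" "a \<noteq> c" "b \<noteq> c"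
  shows "near_regular (cx a) (cx b) (cx c)"
proof -
  have cb: "\<bar>cos_angle x y z - 1/2\<bar> \<le> 152/10000" if "x \<in> T" "y \<in> T" "z \<in> T" "x \<noteq> y" "y \<noteq> z" "x \<noteq> z" for x y z
    using T that cos_angle_bound unfolding almost_regular_def by blast
  have ratio: "\<bar>norm (y - z) - norm (x - z)\<bar> \<le> 205/10000 * norm (x - y)"
    if xyz: "x \<in> T" "y \<in> T" "z \<in> T" "x \<noteq> y" "y \<noteq> z" "x \<noteq> z" for x y z
  proof (rule side_ratio)
    show "norm (x - y) = norm (y - z) * cos_angle x y z + norm (x - z) * cos_angle y x z"
      using projection[of x y z] xyz by simp
    show "norm (y - z) = norm (x - z) * cos_angle x z y + norm (x - y) * cos_angle x y z"
      using projection[of y z x] xyz by (simp add: norm_minus_commute cos_angle_commute)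
    show "norm (x - z) = norm (y - z) * cos_angle x z y + norm (x - y) * cos_angle y x z"
      using projection[of x z y] xyz by (simp add: norm_minus_commute cos_angle_commute)
  qed (use cb xyz in auto)
  define z where "z = (cx c - cx a) / (cx b - cx a)"
  have pos: "0 < norm (a - b)" using ne by simp
  have nz: "norm z = norm (a - c) / norm (a - b)"
    by (simp add: z_def norm_divide cx_diff norm_cx norm_minus_commute)
  have ba: "cx b - cx a \<noteq> 0" using ne by (simp add: cx_inject)
  then have "z - 1 = (cx c - cx b) / (cx b - cx a)" by (simp add: z_def field_simps)
  then have nz1: "norm (z - 1) = norm (b - c) / norm (a - b)"
    by (simp add: norm_divide cx_diff norm_cx norm_minus_commute)
  have quot: "\<bar>p / d - q / d\<bar> \<le> r * (s / d)" if "\<bar>p - q\<bar> \<le> r * s" "0 < d" for p q r s d :: real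
    using divide_right_mono[OF that(1), of d] that(2) by (simp add: diff_divide_distrib[symmetric])
  have 1: "\<bar>norm z - norm (z - 1)\<bar> \<le> 205/10000"
    using quot[OF ratio[of b a c] pos] mem ne pos unfolding nz nz1 by (simp add: norm_minus_commute)
  have 2: "\<bar>norm z - 1\<bar> \<le> 205/10000 * norm (z - 1)"
    using quot[OF ratio[of c b a] pos] mem ne pos unfolding nz nz1 by (simp add: norm_minus_commute)
  have 3: "\<bar>norm (z - 1) - 1\<bar> \<le> 205/10000 * norm z"
    using quot[OF ratio[of c a b] pos] mem ne pos unfolding nz nz1 by (simp add: norm_minus_commute)
  have "norm (z - omega) \<le> 1/40 \<or> norm (z - (1 - omega)) \<le> 1/40"
  proof (cases "0 \<le> Im z")
    case True
    then show ?thesis using near_omega 1 2 3 by blast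
  next
    case False
    have n: "norm (cnj z - w) = norm (z - cnj w)" for w
      by (metis complex_cnj_cnj complex_cnj_diff complex_mod_cnj)
    have "norm (cnj z) = norm z" "norm (cnj z - 1) = norm (z - 1)" using n[of 1] by simp_all
    then have "norm (cnj z - omega) \<le> 1/40" using 1 2 3 False by (intro near_omega) simp_all
    moreover have "cnj omega = 1 - omega" by (simp add: omega_def complex_eq_iff)
    ultimately show ?thesis unfolding n by simp
  qed
  moreover have zd: "z * (cx b - cx a) = cx c - cx a" using ba by (simp add: z_def)
  have "norm (cx c - cx a - t * (cx b - cx a)) = norm (z - t) * norm (cx b - cx a)" for t
    unfolding norm_mult[symmetric] left_diff_distrib zd ..
  moreover have "norm (z - t) * norm (cx b - cx a) \<le> norm (cx b - cx a) / 40" if "norm (z - t) \<le> 1/40" for t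
    using mult_right_mono[OF that, of "norm (cx b - cx a)"] by simp
  ultimately show ?thesis unfolding near_regular_def by metis
qed

lemma near_regular_similar:
  assumes "near_regular a b c" "m \<noteq> 0"
  shows "near_regular ((a - o') / m) ((b - o') / m) ((c - o') / m)"
proof -
  have d: "(x - o') / m - (y - o') / m = (x - y) / m" for x y
    by (simp add: diff_divide_distrib)
  have "norm ((c - a) / m - t * ((b - a) / m)) = norm (c - a - t * (b - a)) / norm m" for t
    unfolding norm_divide[symmetric]
    by (simp only: diff_divide_distrib[of "c - a" "t * (b - a)" m] times_divide_eq_right)
  moreover have "r / norm m \<le> s / norm m / 40" if "r \<le> s / 40" for r s :: real
    using divide_right_mono[OF that, of "norm m"] by (simp add: mult.commute)
  ultimately show ?thesis
    using assms unfolding near_regular_def d norm_divide by metis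
qed

text \<open>Exchanging the endpoints of the base exchanges the two sides.\<close>

lemma near_regular_oriented:
  assumes "near_regular a b c"
  shows "norm (c - a - omega * (b - a)) \<le> norm (b - a) / 40 \<or>
    norm (c - b - omega * (a - b)) \<le> norm (a - b) / 40"
proof -
  have e: "c - a - (1 - omega) * (b - a) = c - b - omega * (a - b)" by (simp add: algebra_simps)
  show ?thesis using assms unfolding near_regular_def e norm_minus_commute[of b a] .
qed

text \<open>Normalize so that \<open>u\<close>, \<open>v\<close>, the endpoints of a diameter, become \<open>0\<close> and \<open>1\<close>. A triangle covering
  this pair has its third vertex \<open>w\<close> near \<^term>\<open>omega\<close>, after exchanging \<open>u\<close> and \<open>v\<close> if it lies on the
  other side. Then the points fall into three caps, and comparing the diameter of a cap with the
  distance of two caps rules out triangles with exactly two vertices in one cap.\<close>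

lemma splits_if_covered:
  assumes S: "finite S" "2 \<le> card S" and cov: "covered almost_regular S"
  shows "splits almost_regular S"
proof -
  have third: "\<exists>w\<in>S. near_regular (cx x) (cx y) (cx w)"
    if xy: "x \<in> S" "y \<in> S" "x \<noteq> y" for x y
  proof -
    from cov xy obtain T where T: "T \<in> triples almost_regular S" "x \<in> T" "y \<in> T"
      unfolding covered_def by blast
    then have "T \<noteq> {x, y}" using xy by (auto simp: triples_def)
    then obtain w where "w \<in> T" "w \<noteq> x" "w \<noteq> y" using T by blast
    then show ?thesis using T xy near_regular_if_almost_regular[of T x y w] by (auto simp: triples_def)
  qed
  obtain p q where pq: "p \<in> S" "q \<in> S" "p \<noteq> q"
    using S by (metis card_le_Suc0_iff_eq not_less_eq_eq numeral_2_eq_2)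
  let ?D = "(\<lambda>(x, y). norm (x - y)) ` (S \<times> S)"
  have D: "finite ?D" "?D \<noteq> {}" using S pq by auto
  then have "Max ?D \<in> ?D" by (rule Max_in)
  then obtain u0 v0 where uv0: "u0 \<in> S" "v0 \<in> S" "Max ?D = norm (u0 - v0)" by auto
  have max0: "norm (x - y) \<le> norm (u0 - v0)" if "x \<in> S" "y \<in> S" for x y
    unfolding uv0(3)[symmetric] using D that by (intro Max_ge) auto
  have ne0: "u0 \<noteq> v0" using max0[OF pq(1,2)] pq(3) by auto
  obtain w where w: "w \<in> S" "near_regular (cx u0) (cx v0) (cx w)" using third uv0 ne0 by blast
  obtain u v where uv: "u \<in> S" "v \<in> S" "u \<noteq> v" "norm (u - v) = norm (u0 - v0)"
    and wn: "norm (cx w - cx u - omega * (cx v - cx u)) \<le> norm (cx v - cx u) / 40"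
    using near_regular_oriented[OF w(2)] uv0 ne0 by (metis norm_minus_commute)
  have max: "norm (x - y) \<le> norm (u - v)" if "x \<in> S" "y \<in> S" for x y
    using max0[OF that] uv(4) by simp
  define m where "m = cx v - cx u"
  have m: "m \<noteq> 0" "norm m = norm (u - v)"
    using uv(3) cx_inject[of v u] by (simp add: m_def, simp add: m_def cx_diff norm_cx norm_minus_commute)
  define f where "f x = (cx x - cx u) / m" for x
  have fd: "f x - f y = (cx x - cx y) / m" for x y by (simp add: f_def diff_divide_distrib)
  have f01: "f u = 0" "f v = 1" using m by (simp_all add: f_def m_def)
  have fw: "norm (f w - omega) \<le> 1/40"
  proof -
    have "f w - omega = (cx w - cx u - omega * (cx v - cx u)) / m"
      using m by (simp add: f_def m_def diff_divide_distrib)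
    then have "norm (f w - omega) = norm (cx w - cx u - omega * (cx v - cx u)) / norm m"
      by (simp add: norm_divide)
    also have "\<dots> \<le> norm m / 40 / norm m"
      using wn by (intro divide_right_mono) (simp_all add: m_def)
    finally show ?thesis using m(1) by simp
  qed
  have near: "near_regular (f x) (f y) (f z)" if "near_regular (cx x) (cx y) (cx z)" for x y z
    unfolding f_def by (rule near_regular_similar[OF that m(1)])
  have caps: "cap (f x) \<or> cap (rot (f x)) \<or> cap (rot (rot (f x)))" if "x \<in> S" for x
  proof (rule three_caps[of "f ` S" "f w"])
    show "0 \<in> f ` S" "1 \<in> f ` S" using f01 uv by (metis imageI)+
    show "norm (x - y) \<le> 1" if "x \<in> f ` S" "y \<in> f ` S" for x y
      using that max m by (auto simp: fd norm_divide cx_diff norm_cx divide_le_eq)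
    show "\<exists>t\<in>f ` S. near_regular x y t" if "x \<in> f ` S" "y \<in> f ` S" "x \<noteq> y" for x y
      using that third near by blast
  qed (use that w fw in auto)
  define k :: "real^2 \<Rightarrow> nat" where
    "k x = (if cap (f x) then 0 else if cap (rot (f x)) then 1 else 2)" for x
  have k: "k x = 0 \<Longrightarrow> cap (f x)" "k x = 1 \<Longrightarrow> cap (rot (f x))"
    "x \<in> S \<Longrightarrow> k x = 2 \<Longrightarrow> cap (rot (rot (f x)))" "k x = 0 \<or> k x = 1 \<or> k x = 2" for x
    using caps[of x] by (auto simp: k_def split: if_splits)
  have same: "norm (f x - f y) \<le> 365/1000" if "x \<in> S" "y \<in> S" "k x = k y" for x y
  proof -
    consider "k x = 0" "k y = 0" | "k x = 1" "k y = 1" | "k x = 2" "k y = 2"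
      using k(4)[of x] \<open>k x = k y\<close> by metis
    then show ?thesis
    proof cases
      case 1 then show ?thesis using cap_diam k by blast
    next
      case 2 then show ?thesis using cap_diam[of "rot (f x)" "rot (f y)"] k norm_rot_diff by auto
    next
      case 3 then show ?thesis
        using cap_diam[of "rot (rot (f x))" "rot (rot (f y))"] k that norm_rot_diff by auto
    qed
  qed
  have less: "39/100 \<le> norm (f x - f y)" if "x \<in> S" "y \<in> S" "k x < k y" for x y
  proof -
    consider "k x = 0" "k y = 1" | "k x = 1" "k y = 2" | "k x = 0" "k y = 2"
      using k(4)[of x] k(4)[of y] \<open>k x < k y\<close> by - (elim disjE; simp)
    then show ?thesis
    proof cases
      case 1 then show ?thesis using cap_sep k by blast
    next
      case 2 then show ?thesis
        using cap_sep[of "rot (f x)" "rot (f y)"] k that norm_rot_diff by auto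
    next
      case 3 then show ?thesis
        using cap_sep[of "rot (rot (f y))" "rot (rot (f x))"] k that norm_rot_diff
        by (simp add: rot_rot_rot norm_minus_commute)
    qed
  qed
  have diff: "39/100 \<le> norm (f x - f y)" if "x \<in> S" "y \<in> S" "k x \<noteq> k y" for x y
    using less[of x y] less[of y x] that by (auto simp: norm_minus_commute neq_iff)
  have nT: "k c = k a"
    if "k a = k b" and T: "T \<in> triples almost_regular S" "a \<in> T" "b \<in> T" "c \<in> T" "a \<noteq> b" "a \<noteq> c" "b \<noteq> c" for T a b c
  proof (rule ccontr)
    assume ne: "k c \<noteq> k a"
    have mem: "a \<in> S" "b \<in> S" "c \<in> S" using T by (auto simp: triples_def)
    have "near_regular (f a) (f b) (f c)"
      using T near_regular_if_almost_regular[of T a b c] by (intro near) (auto simp: triples_def)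
    then have "norm (f c - f a) \<le> 41/40 * norm (f b - f a)" by (rule near_regular_dist)
    then show False
      using same[OF mem(2,1)] diff[OF mem(3,1) ne] \<open>k a = k b\<close> by simp
  qed
  let ?A = "\<lambda>i. {x \<in> S. k x = i}"
  have kuvw: "k u \<noteq> k v" "k u \<noteq> k w" "k v \<noteq> k w"
  proof -
    have "norm (f u - f v) = 1" using f01 by simp
    then show "k u \<noteq> k v" using same[OF uv(1,2)] by auto
    have "1 - 1/40 \<le> norm (f u - f w)"
      using fw f01 norm_omega norm_triangle_ineq2[of omega "omega - f w"] by (simp add: norm_minus_commute)
    then show "k u \<noteq> k w" using same[OF uv(1) w(1)] by auto
    have "norm (1 - omega) \<le> norm (f v - f w) + norm (f w - omega)"
      using norm_triangle_ineq[of "f v - f w" "f w - omega"] f01 by simp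
    then have "1 - 1/40 \<le> norm (f v - f w)" using fw norm_omega by linarith
    then show "k v \<noteq> k w" using same[OF uv(2) w(1)] by auto
  qed
  have "S = ?A 0 \<union> ?A 1 \<union> ?A 2" using k(4) by auto
  moreover have "?A i \<noteq> {}" if "i < 3" for i
  proof -
    have "i \<in> {k u, k v, k w}" using that kuvw k(4)[of u] k(4)[of v] k(4)[of w] by auto
    then show ?thesis using uv w by auto
  qed
  then have "?A 0 \<noteq> {}" "?A 1 \<noteq> {}" "?A 2 \<noteq> {}" by simp_all
  moreover have "?A 0 \<inter> ?A 1 = {}" "?A 0 \<inter> ?A 2 = {}" "?A 1 \<inter> ?A 2 = {}" by auto
  moreover have "T \<subseteq> ?A 0 \<or> T \<subseteq> ?A 1 \<or> T \<subseteq> ?A 2 \<or>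
      (T \<inter> ?A 0 \<noteq> {} \<and> T \<inter> ?A 1 \<noteq> {} \<and> T \<inter> ?A 2 \<noteq> {})"
    if T: "T \<in> triples almost_regular S" for T
  proof -
    from T obtain a b c where abc: "T = {a, b, c}" "a \<noteq> b" "a \<noteq> c" "b \<noteq> c"
      by (auto simp: triples_def card_3_iff)
    have mem: "a \<in> S" "b \<in> S" "c \<in> S" using T unfolding abc(1) triples_def by simp_all
    have n: "k a = k b \<Longrightarrow> k c = k a" "k b = k c \<Longrightarrow> k a = k b" "k a = k c \<Longrightarrow> k b = k a"
    proof -
      have inT: "a \<in> T" "b \<in> T" "c \<in> T" by (simp_all add: abc(1))
      show "k a = k b \<Longrightarrow> k c = k a" using nT T inT abc(2-4) by metis
      show "k b = k c \<Longrightarrow> k a = k b" using nT T inT abc(2-4) by metis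
      show "k a = k c \<Longrightarrow> k b = k a" using nT T inT abc(2-4) by metis
    qed
    show ?thesis
    proof (cases "k a = k b \<or> k a = k c \<or> k b = k c")
      case True
      then have "k b = k a" "k c = k a" using n by metis+
      then have "T \<subseteq> ?A (k a)" using mem abc(1) by simp
      then show ?thesis using k(4)[of a] by metis
    next
      case False
      then have "i \<in> {k a, k b, k c}" if "i < 3" for i
        using that k(4)[of a] k(4)[of b] k(4)[of c] by auto
      then have "T \<inter> ?A i \<noteq> {}" if "i < 3" for i using that mem unfolding abc(1) by auto
      then show ?thesis by simp
    qed
  qed
  ultimately show ?thesis unfolding splits_def
    by (intro exI[of _ "?A 0"] exI[of _ "?A 1"] exI[of _ "?A 2"] conjI ballI) simp_all
qed

text \<open>Unit weights even give \<open>(n ^ 3 - n) / 24\<close>.\<close>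

lemma card_triples_le:
  assumes "finite P"
  shows "real (card (triples almost_regular P)) \<le> real (card P) ^ 3 / 24"
proof -
  have "weight almost_regular (\<lambda>_. 1) P + (\<Sum>p\<in>P. 1 ^ 3) / 24 \<le> (\<Sum>p\<in>P. 1) ^ 3 / 24"
    by (rule weight_bound[OF splits_if_covered assms]) simp_all
  then show ?thesis by (simp add: weight_def)
qed

section \<open>The lower bound\<close>

lemma not_collinear_if_almost_regular:
  assumes "almost_regular T" "card T = 3"
  shows "\<not> collinear T"
proof
  assume col: "collinear T"
  obtain a b c where T: "T = {a, b, c}" and ne: "a \<noteq> b" "a \<noteq> c" "b \<noteq> c"
    using assms(2) by (auto simp: card_3_iff)
  have "collinear {0, a - b, c - b}"
    using col unfolding T by (simp add: collinear_3)
  then have "\<bar>inner (a - b) (c - b)\<bar> = norm (a - b) * norm (c - b)"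
    by (simp add: norm_cauchy_schwarz_equal)
  then have "\<bar>cos_angle a b c\<bar> = 1" using ne by (simp add: cos_angle_def abs_mult)
  moreover have "\<bar>cos_angle a b c - 1/2\<bar> \<le> 152/10000"
  proof (rule cos_angle_bound)
    have "59 < angle_deg a b c \<and> angle_deg a b c < 61"
      using assms(1) ne unfolding almost_regular_def T by blast
    then show "59 < angle_deg a b c" "angle_deg a b c < 61" by auto
  qed
  ultimately show False by linarith
qed

lemma almost_regular_triangles: "{T \<in> triangles P. almost_regular T} = triples almost_regular P"
  using not_collinear_if_almost_regular by (auto simp: triangles_def triples_def)

lemma h_attained: "\<exists>P. finite P \<and> card P = n \<and> card (triples almost_regular P) = h n"
  using Max_in[OF h_set_finite[of n] h_set_nonempty[of n]]
  unfolding h_def almost_regular_triangles by auto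

lemma card_triples_le_h:
  assumes "finite P"
  shows "card (triples almost_regular P) \<le> h (card P)"
  unfolding h_def almost_regular_triangles
  by (rule Max_ge) (use h_set_finite[of "card P"] assms in \<open>auto simp: almost_regular_triangles\<close>)

lemma h_le: "real (h n) \<le> real n ^ 3 / 24"
  using h_attained[of n] card_triples_le by metis

lemma angle_deg_homothety:
  assumes "0 < r"
  shows "angle_deg (e + r *\<^sub>R a) (e + r *\<^sub>R b) (e + r *\<^sub>R c) = angle_deg a b c"
proof -
  have d: "(e + r *\<^sub>R x) - (e + r *\<^sub>R y) = r *\<^sub>R (x - y)" for x y
    by (simp add: scaleR_diff_right)
  show ?thesis using assms unfolding angle_deg_def d by simp
qed

text \<open>Homotheties preserve angles, so an optimal set has copies of any size anywhere.\<close>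

lemma shrink:
  assumes P: "finite P" and eps: "0 < \<epsilon>"
  obtains Q where "Q \<subseteq> ball e \<epsilon>" "finite Q" "card Q = card P"
    "card (triples almost_regular P) \<le> card (triples almost_regular Q)"
proof -
  obtain B where B: "0 < B" "\<And>x. x \<in> P \<Longrightarrow> norm x \<le> B"
    using finite_imp_bounded[OF P] by (meson bounded_pos)
  define r where "r = \<epsilon> / (2 * B)"
  have r: "0 < r" using B eps by (simp add: r_def)
  define f where "f x = e + r *\<^sub>R x" for x
  have inj: "inj f" using r by (auto simp: f_def inj_def)
  have ar: "almost_regular (f ` T)" if "almost_regular T" for T
    using that angle_deg_homothety[OF r] unfolding almost_regular_def f_def by auto
  have "f ` P \<subseteq> ball e \<epsilon>"
  proof
    fix y assume "y \<in> f ` P"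
    then obtain x where x: "x \<in> P" "y = f x" by auto
    have "norm (r *\<^sub>R x) \<le> r * B" using r B(2)[OF x(1)] by simp
    also have "\<dots> < \<epsilon>" using B eps by (simp add: r_def)
    finally show "y \<in> ball e \<epsilon>" by (simp add: x f_def dist_norm)
  qed
  moreover have "card (f ` P) = card P" using inj by (simp add: card_image inj_on_subset)
  moreover have "card (triples almost_regular P) \<le> card (triples almost_regular (f ` P))"
  proof (rule card_inj_on_le)
    show "inj_on (image f) (triples almost_regular P)" using inj by (auto simp: inj_on_def inj_image_eq_iff)
    show "image f ` triples almost_regular P \<subseteq> triples almost_regular (f ` P)"
      using ar inj by (auto simp: triples_def card_image inj_on_subset)
    show "finite (triples almost_regular (f ` P))" using P by (intro finite_triples) simp
  qed
  ultimately show ?thesis using that P by blast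
qed

text \<open>A 60 degree angle stays between 59 and 61 degrees under a small perturbation of the three
  points, as \<^term>\<open>arccos\<close> is continuous at \<open>1/2\<close>.\<close>

lemma angle_deg_near:
  assumes "p \<noteq> q" "r \<noteq> q" "cos_angle p q r = 1/2"
  shows "\<exists>\<epsilon>>0. \<forall>a\<in>ball p \<epsilon>. \<forall>b\<in>ball q \<epsilon>. \<forall>c\<in>ball r \<epsilon>.
    59 < angle_deg a b c \<and> angle_deg a b c < 61"
proof -
  let ?g = "\<lambda>t. cos_angle (fst t) (fst (snd t)) (snd (snd t))"
  let ?f = "\<lambda>t. angle_deg (fst t) (fst (snd t)) (snd (snd t))"
  have f: "?f = (\<lambda>t. arccos (?g t) * (180 / pi))" by (simp add: angle_deg_def cos_angle_def)
  have "isCont ?g (p, q, r)"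
    unfolding cos_angle_def using assms(1,2) by (intro continuous_intros) auto
  then have "isCont (\<lambda>t. arccos (?g t)) (p, q, r)"
    by (rule isCont_o2) (simp only: fst_conv snd_conv assms(3), rule isCont_arccos, simp_all)
  then have cont: "isCont ?f (p, q, r)" unfolding f by (intro continuous_intros)
  have "arccos (1/2) = pi / 3" by (rule arccos_unique) (auto simp: cos_60)
  moreover have "?f (p, q, r) = arccos (cos_angle p q r) * (180 / pi)"
    by (simp add: angle_deg_def cos_angle_def)
  ultimately have "?f (p, q, r) = 60" unfolding assms(3) by simp
  then obtain d where d: "0 < d" "\<And>t. dist t (p, q, r) < d \<Longrightarrow> dist (?f t) 60 < 1"
    using cont unfolding continuous_at_eps_delta by (metis zero_less_one)
  show ?thesis
  proof (intro exI conjI ballI)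
    show "0 < d / 3" using d by simp
    fix a b c assume abc: "a \<in> ball p (d / 3)" "b \<in> ball q (d / 3)" "c \<in> ball r (d / 3)"
    have "dist (a, b, c) (p, q, r) \<le> dist a p + (dist b q + dist c r)"
      unfolding dist_Pair_Pair
      by (rule order.trans[OF sqrt_sum_squares_le_sum]) (auto intro: sqrt_sum_squares_le_sum)
    also have "\<dots> < d" using abc by (simp add: dist_commute)
    finally have "\<bar>angle_deg a b c - 60\<bar> < 1" using d(2)[of "(a, b, c)"] by (simp add: dist_real_def)
    then show "59 < angle_deg a b c" "angle_deg a b c < 61" by linarith+
  qed
qed

lemma regular_position:
  obtains p q r :: "real^2" and \<epsilon> where "0 < \<epsilon>"
    "ball p \<epsilon> \<inter> ball q \<epsilon> = {}" "ball p \<epsilon> \<inter> ball r \<epsilon> = {}" "ball q \<epsilon> \<inter> ball r \<epsilon> = {}"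
    "\<And>a b c. a \<in> ball p \<epsilon> \<Longrightarrow> b \<in> ball q \<epsilon> \<Longrightarrow> c \<in> ball r \<epsilon> \<Longrightarrow> almost_regular {a, b, c}"
proof -
  define p q r :: "real^2" where "p = 0" and "q = vector [1, 0]" and "r = vector [1/2, sqrt 3 / 2]"
  have n: "norm (p - q) = 1" "norm (p - r) = 1" "norm (q - r) = 1"
    by (simp_all add: p_def q_def r_def norm_eq_sqrt_inner inner_vec_def sum_2 power_divide
        flip: power2_eq_square)
  have c: "cos_angle p q r = 1/2" "cos_angle q p r = 1/2" "cos_angle p r q = 1/2"
    unfolding cos_angle_def using n
    by (simp_all add: norm_minus_commute)
       (simp_all add: p_def q_def r_def inner_vec_def sum_2 power_divide flip: power2_eq_square)
  have ne: "p \<noteq> q" "p \<noteq> r" "q \<noteq> r" using n by auto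
  obtain e1 where e1: "0 < e1" "\<forall>a\<in>ball p e1. \<forall>b\<in>ball q e1. \<forall>c\<in>ball r e1.
    59 < angle_deg a b c \<and> angle_deg a b c < 61"
    using angle_deg_near[OF _ _ c(1)] ne by auto
  obtain e2 where e2: "0 < e2" "\<forall>a\<in>ball q e2. \<forall>b\<in>ball p e2. \<forall>c\<in>ball r e2.
    59 < angle_deg a b c \<and> angle_deg a b c < 61"
    using angle_deg_near[OF _ _ c(2)] ne by auto
  obtain e3 where e3: "0 < e3" "\<forall>a\<in>ball p e3. \<forall>b\<in>ball r e3. \<forall>c\<in>ball q e3.
    59 < angle_deg a b c \<and> angle_deg a b c < 61"
    using angle_deg_near[OF _ _ c(3)] ne by auto
  define \<epsilon> where "\<epsilon> = min (1/2) (min e1 (min e2 e3))"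
  have eps: "0 < \<epsilon>" "\<epsilon> \<le> 1/2" "\<epsilon> \<le> e1" "\<epsilon> \<le> e2" "\<epsilon> \<le> e3"
    using e1(1) e2(1) e3(1) by (auto simp: \<epsilon>_def)
  have disj: "ball x \<epsilon> \<inter> ball y \<epsilon> = {}" if "norm (x - y) = 1" for x y :: "real^2"
    using that eps by (intro disjoint_ballI) (simp add: dist_norm)
  have comm: "angle_deg x y z = angle_deg z y x" for x y z
    by (simp add: angle_deg_def inner_commute mult.commute)
  have "almost_regular {a, b, c}" if "a \<in> ball p \<epsilon>" "b \<in> ball q \<epsilon>" "c \<in> ball r \<epsilon>" for a b c
  proof -
    have "59 < angle_deg a b c \<and> angle_deg a b c < 61" "59 < angle_deg b a c \<and> angle_deg b a c < 61"
      "59 < angle_deg a c b \<and> angle_deg a c b < 61"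
      using that eps e1(2) e2(2) e3(2) by auto
    then show ?thesis
      using comm[of a b c] comm[of b a c] comm[of a c b] unfolding almost_regular_def by auto
  qed
  then show ?thesis using that[OF eps(1) disj[OF n(1)] disj[OF n(2)] disj[OF n(3)]] by blast
qed

lemma card_Un4_disjoint:
  assumes "finite W" "finite X" "finite Y" "finite Z"
    and "W \<inter> X = {}" "W \<inter> Y = {}" "W \<inter> Z = {}" "X \<inter> Y = {}" "X \<inter> Z = {}" "Y \<inter> Z = {}"
  shows "card (W \<union> X \<union> Y \<union> Z) = card W + card X + card Y + card Z"
  using assms by (simp add: card_Un_disjoint Int_Un_distrib2)

text \<open>Put tiny copies of optimal sets with \<open>a\<close>, \<open>b\<close> and \<open>c\<close> points at the vertices of a regular
  triangle. Every choice of one point from each copy gives a nearly regular triangle.\<close>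

lemma h_superadditive: "a * b * c + h a + h b + h c \<le> h (a + b + c)"
proof -
  obtain p q r :: "real^2" and \<epsilon> where eps: "0 < \<epsilon>"
    and disj: "ball p \<epsilon> \<inter> ball q \<epsilon> = {}" "ball p \<epsilon> \<inter> ball r \<epsilon> = {}" "ball q \<epsilon> \<inter> ball r \<epsilon> = {}"
    and ar: "\<And>a b c. a \<in> ball p \<epsilon> \<Longrightarrow> b \<in> ball q \<epsilon> \<Longrightarrow> c \<in> ball r \<epsilon> \<Longrightarrow> almost_regular {a, b, c}"
    using regular_position by metis
  have opt: "\<exists>Q. Q \<subseteq> ball x \<epsilon> \<and> finite Q \<and> card Q = n \<and> h n \<le> card (triples almost_regular Q)" for x n
  proof -
    obtain P where P: "finite P" "card P = n" "card (triples almost_regular P) = h n"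
      using h_attained by blast
    show ?thesis using shrink[OF P(1) eps, of x] P by metis
  qed
  let ?t = "triples almost_regular"
  obtain A where A: "A \<subseteq> ball p \<epsilon>" "finite A" "card A = a" "h a \<le> card (?t A)" using opt by blast
  obtain B where B: "B \<subseteq> ball q \<epsilon>" "finite B" "card B = b" "h b \<le> card (?t B)" using opt by blast
  obtain C where C: "C \<subseteq> ball r \<epsilon>" "finite C" "card C = c" "h c \<le> card (?t C)" using opt by blast
  have AB: "A \<inter> B = {}" "A \<inter> C = {}" "B \<inter> C = {}"
    using disj A(1) B(1) C(1) by blast+
  let ?X = "(\<lambda>(a, b, c). {a, b, c}) ` (A \<times> B \<times> C)"
  let ?P = "A \<union> B \<union> C"
  have fin: "finite ?X" "finite (?t A)" "finite (?t B)" "finite (?t C)" "finite (?t ?P)"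
    using A(2) B(2) C(2) by (auto intro: finite_triples)
  have cX: "card ?X = a * b * c"
    using card_image[OF inj_on_transversal[OF AB]] A(3) B(3) C(3) by (simp add: card_cartesian_product)
  have disjt: "?t U \<inter> ?t V = {}" if "U \<inter> V = {}" for U V
  proof -
    have "T = {}" if "T \<subseteq> U" "T \<subseteq> V" for T using that \<open>U \<inter> V = {}\<close> by blast
    then have "card T \<noteq> 3" if "T \<subseteq> U" "T \<subseteq> V" for T
      using that by (metis card.empty zero_neq_numeral)
    then show ?thesis unfolding triples_def by blast
  qed
  have disjX: "?X \<inter> ?t A = {}" "?X \<inter> ?t B = {}" "?X \<inter> ?t C = {}"
    using AB by (auto simp: triples_def)
  have "?X \<subseteq> ?t ?P"
  proof
    fix T assume "T \<in> ?X"
    then obtain x y z where T: "T = {x, y, z}" "x \<in> A" "y \<in> B" "z \<in> C" by auto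
    then have "x \<noteq> y" "x \<noteq> z" "y \<noteq> z" using AB by auto
    moreover have "almost_regular {x, y, z}" using T A(1) B(1) C(1) by (intro ar) blast+
    ultimately show "T \<in> ?t ?P" using T by (simp add: triples_def)
  qed
  moreover have "?t A \<subseteq> ?t ?P" "?t B \<subseteq> ?t ?P" "?t C \<subseteq> ?t ?P" by (auto simp: triples_def)
  ultimately have "card (?X \<union> ?t A \<union> ?t B \<union> ?t C) \<le> card (?t ?P)"
    using fin by (intro card_mono) auto
  moreover have "card (?X \<union> ?t A \<union> ?t B \<union> ?t C) = card ?X + card (?t A) + card (?t B) + card (?t C)"
    by (rule card_Un4_disjoint[OF fin(1-4) disjX disjt[OF AB(1)] disjt[OF AB(2)] disjt[OF AB(3)]])
  moreover have "card (?t ?P) \<le> h (a + b + c)"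
  proof -
    have "card ?P = a + b + c" using A B C AB by (simp add: card_Un_disjoint Int_Un_distrib2)
    then show ?thesis using card_triples_le_h[of ?P] A(2) B(2) C(2) by simp
  qed
  ultimately show ?thesis using cX A(4) B(4) C(4) by linarith
qed

lemma balanced_parts:
  assumes "3 \<le> n"
  obtains a b c :: nat where "a + b + c = n" "1 \<le> a" "a \<le> b" "b \<le> c" "c \<le> a + 1" "c < n" "3 * c \<le> n + 2"
proof -
  obtain q s where qs: "n = 3 * q + s" "s < 3"
    by (metis mod_less_divisor mult_div_mod_eq zero_less_numeral)
  then have "1 \<le> q" using assms by linarith
  from qs(2) consider "s = 0" | "s = 1" | "s = 2" by linarith
  then show ?thesis
  proof cases
    case 1 then show ?thesis using that[of q q q] qs(1) \<open>1 \<le> q\<close> by simp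
  next
    case 2 then show ?thesis using that[of q q "q + 1"] qs(1) \<open>1 \<le> q\<close> by simp
  next
    case 3 then show ?thesis using that[of q "q + 1" "q + 1"] qs(1) \<open>1 \<le> q\<close> by simp
  qed
qed

text \<open>Split \<open>n\<close> as evenly as possible. The defect \<open>Q / 8\<close> in \<open>cube_split\<close> is at most \<open>n / 8\<close>, since
  the parts differ by at most 1. The parts are at most \<open>5/9 * n\<close>, so passing to them decreases the
  logarithm by at least \<open>4/9\<close>, which pays for this defect.\<close>

lemma h_ge:
  assumes "1 \<le> n"
  shows "real n ^ 3 / 24 - real (h n) \<le> real n * (1 + ln (real n))"
  using assms
proof (induction n rule: less_induct)
  case (less n)
  consider "n = 1" | "n = 2" | "3 \<le> n" using less.prems by linarith
  then show ?case
  proof cases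
    case 1
    then show ?thesis by simp
  next
    case 2
    have "0 \<le> ln (2::real)" by simp
    then have "real n ^ 3 / 24 \<le> real n * (1 + ln (real n))" unfolding 2 by simp
    moreover have "0 \<le> real (h n)" by simp
    ultimately show ?thesis by linarith
  next
    case 3
    obtain a b c where abc: "a + b + c = n" "1 \<le> a" "a \<le> b" "b \<le> c" "c \<le> a + 1" "c < n" "3 * c \<le> n + 2"
      using balanced_parts[OF 3] .
    define x y z where "x = real a" and "y = real b" and "z = real c"
    have xyz: "x + y + z = real n" "1 \<le> x" "x \<le> y" "y \<le> z" "z \<le> x + 1"
      using abc unfolding x_def y_def z_def by linarith+
    define Q where "Q = x * (y - z)\<^sup>2 + y * (z - x)\<^sup>2 + z * (x - y)\<^sup>2"
    have "Q \<le> x * 1 + y * 1 + z * 1"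
      unfolding Q_def using xyz by (intro add_mono mult_left_mono) (auto simp: abs_square_le_1)
    then have Q: "Q \<le> real n" using xyz(1) by simp
    have "(x + y + z) ^ 3 / 24 = x ^ 3 / 24 + y ^ 3 / 24 + z ^ 3 / 24 + x * y * z + Q / 8"
      unfolding Q_def by (simp add: power2_eq_square power3_eq_cube field_simps)
    then have cube: "real n ^ 3 / 24 = x ^ 3 / 24 + y ^ 3 / 24 + z ^ 3 / 24 + x * y * z + Q / 8"
      unfolding xyz(1) .
    have super: "x * y * z + real (h a) + real (h b) + real (h c) \<le> real (h n)"
      using h_superadditive[of a b c] unfolding abc(1) x_def y_def z_def
      by (metis of_nat_add of_nat_le_iff of_nat_mult)
    have IH: "real k ^ 3 / 24 - real (h k) \<le> real k * (1 + (ln n - 4/9))"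
      if k: "k \<in> {a, b, c}" for k
    proof -
      have kn: "1 \<le> k" "k \<le> c" "k < n" using k abc by auto
      have "real k \<le> 5/9 * real n" using kn abc(7) 3 by linarith
      then have "ln (real k) \<le> ln (5/9 * real n)" using kn by simp
      also have "\<dots> = ln (5/9) + ln (real n)" using 3 by (subst ln_mult) auto
      also have "ln (5/9 :: real) \<le> 5/9 - 1" by (rule ln_le_minus_one) simp
      finally have "ln (real k) \<le> ln n - 4/9" by simp
      then have "real k * (1 + ln (real k)) \<le> real k * (1 + (ln n - 4/9))"
        by (intro mult_left_mono) auto
      then show ?thesis using less.IH[OF kn(3,1)] by linarith
    qed
    have parts: "x ^ 3 / 24 - real (h a) \<le> x * (1 + (ln n - 4/9))"
      "y ^ 3 / 24 - real (h b) \<le> y * (1 + (ln n - 4/9))" "z ^ 3 / 24 - real (h c) \<le> z * (1 + (ln n - 4/9))"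
      unfolding x_def y_def z_def by (rule IH; simp)+
    have "real n ^ 3 / 24 - real (h n) \<le>
        (x ^ 3 / 24 - real (h a)) + (y ^ 3 / 24 - real (h b)) + (z ^ 3 / 24 - real (h c)) + Q / 8"
      using cube super by linarith
    also have "\<dots> \<le> x * (1 + (ln n - 4/9)) + y * (1 + (ln n - 4/9)) + z * (1 + (ln n - 4/9)) + real n / 8"
      using parts Q by (intro add_mono) simp_all
    also have "\<dots> = real n * (1 + ln n) - 4/9 * real n + real n / 8"
      unfolding xyz(1)[symmetric] by (simp add: field_simps)
    also have "\<dots> \<le> real n * (1 + ln n)" by simp
    finally show ?thesis .
  qed
qed

theorem mainTheorem4:
  shows "(\<lambda>n. real (h n) - real n ^ 3 / 24) \<in> O(\<lambda>n. real n * ln (real n))"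
proof (rule bigoI[where c = 2])
  have "norm (real (h n) - real n ^ 3 / 24) \<le> 2 * norm (real n * ln (real n))" if n: "3 \<le> n" for n
  proof -
    have "exp 1 \<le> real n" using exp_le n by linarith
    then have "1 \<le> ln (real n)" using n by (subst ln_ge_iff) auto
    then have "real n * (1 + ln (real n)) \<le> real n * (2 * ln (real n))"
      by (intro mult_left_mono) auto
    then have "real n ^ 3 / 24 - real (h n) \<le> 2 * (real n * ln (real n))"
      using h_ge[of n] n by linarith
    moreover have nn: "0 \<le> real n * ln (real n)" using \<open>1 \<le> ln (real n)\<close> by simp
    ultimately show ?thesis
      unfolding real_norm_def abs_of_nonneg[OF nn] using h_le[of n] by (intro abs_leI) linarith+
  qed
  then show "\<forall>\<^sub>F n in at_top. norm (real (h n) - real n ^ 3 / 24) \<le> 2 * norm (real n * ln (real n))"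
    using eventually_at_top_linorder by blast
qed

end
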